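(* Let $\mathcal{F}$ be a monotone class of graphs and assume that there is a function $f$ such that for any $r\ge1$, $\mathcal{F}$ has an $(r,5r-1)$-distance sketch of size $f(r)$. Then $\mathcal{F}$ has bounded expansion.
   Context: A class of graphs is a set of finite graphs closed under isomorphism; monotone means closed under subgraphs. For $r_1\le r_2$, an $(r_1,r_2)$-distance (distance-$(r_1,r_2)$) sketch of size $s$ for $\mathcal{F}$ is a function $D:\{0,1\}^*\times\{0,1\}^*\to\{0,1\}$ such that for every $G\in\mathcal{F}$ there is a probability distribution over functions $\mathsf{sk}:V(G)\to\{0,1\}^{s}$ such that for all $x,y\in V(G)$: if $\mathsf{dist}_G(x,y)\le r_1$ then $\Pr[D(\mathsf{sk}(x),\mathsf{sk}(y))=1]\ge2/3$, and if $\mathsf{dist}_G(x,y)>r_2$ then $\Pr[D(\mathsf{sk}(x),\mathsf{sk}(y))=0]\ge2/3$. Bounded expansion: a depth-$r$ minor of $G$ is obtained from a subgraph of $G$ by contracting pairwise disjoint connected subgraphs of radius at most $r$; $\mathcal{F}$ has bounded expansion if there is a function $g$ with every depth-$r$ minor of a graph in $\mathcal{F}$ having average degree at most $g(r)$, for all $r\ge0$. *)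

theory Defs
  imports
    "HOL-Probability.Probability_Mass_Function"
    "Graph_Theory.Pair_Digraph"
    "Graph_Theory.Digraph_Component"
    "Graph_Theory.Digraph_Isomorphism"
    "Graph_Theory.Shortest_Path"
begin

text \<open>
  Finite simple graphs are values satisfying \<^const>\<open>pair_graph\<close>: finite, loop-free and symmetric,
  so each edge is stored as two opposite arcs. The null graph is allowed.
\<close>

definition graph_subgraph :: "'a pair_pre_digraph \<Rightarrow> 'a pair_pre_digraph \<Rightarrow> bool" where
  "graph_subgraph H G \<longleftrightarrow> pair_graph H \<and> subgraph (with_proj H) (with_proj G)"

text \<open>
  With an infinite vertex type such as \<^typ>\<open>nat\<close>, every finite graph has an isomorphic
  copy over that type, so a class of finite graphs is determined by its members there.
\<close>

definition graph_class :: "'a pair_pre_digraph set \<Rightarrow> bool" where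
  "graph_class \<F> \<longleftrightarrow>
     (\<forall>G\<in>\<F>. pair_graph G) \<and>
     (\<forall>G\<in>\<F>. \<forall>H. pair_graph H \<longrightarrow> digraph_iso (with_proj G) (with_proj H) \<longrightarrow> H \<in> \<F>)"

definition monotone_class :: "'a pair_pre_digraph set \<Rightarrow> bool" where
  "monotone_class \<F> \<longleftrightarrow> (\<forall>G\<in>\<F>. \<forall>H. graph_subgraph H G \<longrightarrow> H \<in> \<F>)"

text \<open>The unweighted distance; it is infinite between different components.\<close>

definition graph_dist :: "'a pair_pre_digraph \<Rightarrow> 'a \<Rightarrow> 'a \<Rightarrow> ereal" where
  "graph_dist G x y = wf_digraph.\<mu> (with_proj G) (\<lambda>_. 1) x y"

text \<open>
  A decoder takes two bit strings of any length. A sketch is a function on the vertex set, represented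
  as an extensional function; there are finitely many of them for a given graph and size, so
  a probability mass function is a fully general probability distribution.
\<close>

definition distance_sketch ::
    "(bool list \<Rightarrow> bool list \<Rightarrow> bool) \<Rightarrow> nat \<Rightarrow> nat \<Rightarrow> nat \<Rightarrow> 'a pair_pre_digraph set \<Rightarrow> bool" where
  "distance_sketch D r1 r2 s \<F> \<longleftrightarrow>
     (\<forall>G\<in>\<F>. \<exists>P :: ('a \<Rightarrow> bool list) pmf.
        set_pmf P \<subseteq> (pverts G \<rightarrow>\<^sub>E {w. length w = s}) \<and>
        (\<forall>x\<in>pverts G. \<forall>y\<in>pverts G.
           (graph_dist G x y \<le> ereal (real r1) \<longrightarrow>
              measure_pmf.prob P {sk. D (sk x) (sk y)} \<ge> 2/3) \<and>
           (graph_dist G x y > ereal (real r2) \<longrightarrow>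
              measure_pmf.prob P {sk. \<not> D (sk x) (sk y)} \<ge> 2/3)))"

definition has_distance_sketch :: "'a pair_pre_digraph set \<Rightarrow> nat \<Rightarrow> nat \<Rightarrow> nat \<Rightarrow> bool" where
  "has_distance_sketch \<F> r1 r2 s \<longleftrightarrow> (\<exists>D. distance_sketch D r1 r2 s \<F>)"

definition graph_radius :: "'a pair_pre_digraph \<Rightarrow> ereal" where
  "graph_radius G = (INF c\<in>pverts G. SUP v\<in>pverts G. graph_dist G c v)"

text \<open>
  Contracting pairwise disjoint subgraphs \<open>\<S>\<close> of \<open>H\<close>: a vertex of the result is the set of vertices
  of \<open>H\<close> merged into it, a singleton for a vertex outside all members of \<open>\<S>\<close>. Loops and parallel
  edges are dropped.
\<close>

definition contract_verts :: "'a pair_pre_digraph \<Rightarrow> 'a pair_pre_digraph set \<Rightarrow> 'a set set" where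
  "contract_verts H \<S> =
     pverts ` \<S> \<union> {{v} |v. v \<in> pverts H \<and> (\<forall>S\<in>\<S>. v \<notin> pverts S)}"

definition contract :: "'a pair_pre_digraph \<Rightarrow> 'a pair_pre_digraph set \<Rightarrow> 'a set pair_pre_digraph" where
  "contract H \<S> =
     \<lparr> pverts = contract_verts H \<S>,
       parcs = {(A, B). A \<in> contract_verts H \<S> \<and> B \<in> contract_verts H \<S> \<and> A \<noteq> B \<and>
                        (\<exists>a\<in>A. \<exists>b\<in>B. (a, b) \<in> parcs H)} \<rparr>"

definition depth_minor :: "nat \<Rightarrow> 'a set pair_pre_digraph \<Rightarrow> 'a pair_pre_digraph \<Rightarrow> bool" where
  "depth_minor r M G \<longleftrightarrow>
     (\<exists>H \<S>. graph_subgraph H G \<and>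
        (\<forall>S\<in>\<S>. graph_subgraph S H \<and> Digraph_Component.connected (with_proj S) \<and>
                graph_radius S \<le> ereal (real r)) \<and>
        pairwise (\<lambda>S T. pverts S \<inter> pverts T = {}) \<S> \<and>
        M = contract H \<S>)"

text \<open>The out-degree of a vertex in a symmetric digraph is its degree as a graph vertex.\<close>

definition average_degree :: "'a pair_pre_digraph \<Rightarrow> real" where
  "average_degree G =
     (\<Sum>v\<in>pverts G. real (out_degree (with_proj G) v)) / real (card (pverts G))"

definition bounded_expansion :: "'a pair_pre_digraph set \<Rightarrow> bool" where
  "bounded_expansion \<F> \<longleftrightarrow>
     (\<exists>g :: nat \<Rightarrow> real. \<forall>r. \<forall>G\<in>\<F>. \<forall>M. depth_minor r M G \<longrightarrow> average_degree M \<le> g r)"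

lemma pair_graph_depth_minor:
  assumes "depth_minor r M G"
  shows "pair_graph M"
proof -
  from assms obtain H \<S> where H: "graph_subgraph H G"
    and S: "\<forall>S\<in>\<S>. graph_subgraph S H" and M: "M = contract H \<S>"
    unfolding depth_minor_def by blast
  interpret H: pair_graph H using H by (simp add: graph_subgraph_def)
  have "pverts M \<subseteq> Pow (pverts H)"
    using S by (auto simp: M contract_def contract_verts_def graph_subgraph_def subgraph_def)
  then have fin: "finite (pverts M)"
    using H.pair_finite_verts by (meson finite_Pow_iff finite_subset)
  have "parcs M \<subseteq> pverts M \<times> pverts M" by (auto simp: M contract_def)
  then have "finite (parcs M)" using fin by (meson finite_SigmaI finite_subset)
  moreover have "symmetric (with_proj M)"
    unfolding symmetric_def
    by (auto simp: M contract_def intro!: symI) (meson H.arcs_symmetric)+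
  ultimately show ?thesis
    using fin by unfold_locales (auto simp: M contract_def)
qed

end

theory Submission
  imports Defs "HOL-Library.Ramsey"
begin

text \<open>
  A depth-\<open>r\<close> minor of large average degree yields a dense bipartite graph \<open>R\<close> whose edges are realised in \<open>G\<close> by
  internally disjoint paths of one common length \<open>l \<le> 2 r + 1\<close>. Following Kuehn and Osthus, a dense bipartite graph
  contains a dense \<open>C\<^sub>4\<close>-free subgraph or a 1-subdivision of a large clique, and hence of a dense bipartite \<open>C\<^sub>4\<close>-free graph.
  So \<open>G\<close> contains, for some bounded \<open>l\<close>, such paths for the edges of a dense bipartite \<open>C\<^sub>4\<close>-free graph \<open>Q\<close>.
  For \<open>S \<subseteq> Q\<close>, keep only the paths of the edges in \<open>S\<close>: the ends of an edge in \<open>S\<close> are at distance at most \<open>l\<close>, and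
  those of an edge in \<open>Q - S\<close> at distance at least \<open>5 l\<close>, as \<open>Q\<close> has girth at least 6. By averaging, some value of an
  \<open>(l, 5 l - 1)\<close>-sketch of size \<open>s\<close> decides membership in \<open>S\<close> correctly for two thirds of \<open>Q\<close>. There are at most
  \<open>2 ^ (s n)\<close> such values on the \<open>n\<close> vertices of \<open>Q\<close>, each good for few \<open>S\<close>, so \<open>Q\<close> has at most \<open>13 s n\<close> edges.
\<close>

section \<open>Dense bipartite graphs\<close>

text \<open>The ratio 5 is dictated by 4-cycles. Deleting an edge of a bipartite graph leaves its
  ends joined only by walks of odd length; in a dense graph full of 4-cycles that length can be 3, a
  range in which the sketch may answer anything, while without 4-cycles it is at least 5. Paths of
  one common length are needed because only then does a single pair of radii separate kept edges
  from deleted ones. The count succeeds for three reasons: monotonicity puts the graphs of all 2^m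
  choices of \<open>S\<close> into the class, the decoder is the same for all of them, and a sketch
  has to be recorded only at the ends of the paths, however many inner vertices there are. Errors on
  a third of the edges are affordable since there are at most (27/4)^(m/3) such error sets,
  exponentially fewer than 2^m = 8^(m/3).\<close>

definition C4_free :: "('a \<times> 'b) set \<Rightarrow> bool" where
  "C4_free R \<longleftrightarrow> (\<forall>x x' y y'. (x, y) \<in> R \<longrightarrow> (x, y') \<in> R \<longrightarrow> (x', y) \<in> R \<longrightarrow> (x', y') \<in> R \<longrightarrow> x = x' \<or> y = y')"

text \<open>A relation stands for a bipartite graph whose sides are its domain and its range,
  counted separately even if they share elements. There are no isolated vertices, so passing to
  fewer edges may also discard vertices.\<close>

definition dense_bip :: "nat \<Rightarrow> ('a \<times> 'b) set \<Rightarrow> bool" where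
  "dense_bip k R \<longleftrightarrow> finite R \<and> R \<noteq> {} \<and> k * (card (Domain R) + card (Range R)) \<le> card R"

text \<open>Both sides of \<open>Q\<close> are drawn from the range of \<open>R\<close>, so their
  disjointness has to be demanded; the subdividing vertices come from the domain of
  \<open>R\<close>.\<close>

definition one_subdivision :: "('b \<times> 'b) set \<Rightarrow> ('a \<times> 'b) set \<Rightarrow> bool" where
  "one_subdivision Q R \<longleftrightarrow> Domain Q \<inter> Range Q = {} \<and>
     (\<exists>\<alpha>. inj_on \<alpha> Q \<and> (\<forall>i j. (i, j) \<in> Q \<longrightarrow> (\<alpha> (i, j), i) \<in> R \<and> (\<alpha> (i, j), j) \<in> R))"

lemma C4_freeD:
  "C4_free R \<Longrightarrow> (x, y) \<in> R \<Longrightarrow> (x, y') \<in> R \<Longrightarrow> (x', y) \<in> R \<Longrightarrow> (x', y') \<in> R \<Longrightarrow> x = x' \<or> y = y'"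
  unfolding C4_free_def by blast

section \<open>Counting the edges of a relation by rows, and explicit examples\<close>

lemma card_eq_sum_Image:
  assumes "finite R" "finite X" "Domain R \<subseteq> X"
  shows "card R = (\<Sum>x\<in>X. card (R `` {x}))"
proof -
  have "R = (SIGMA x:X. R `` {x})" using assms by auto
  then have "card R = card (SIGMA x:X. R `` {x})" by simp
  also have "\<dots> = (\<Sum>x\<in>X. card (R `` {x}))"
    using assms by (subst card_SigmaI) auto
  finally show ?thesis .
qed

lemma card_le_Domain_mult:
  assumes "finite R" "finite X" "Domain R \<subseteq> X" "\<And>x. x \<in> X \<Longrightarrow> card (R `` {x}) \<le> n"
  shows "card R \<le> card X * n"
  using card_eq_sum_Image[OF assms(1-3)] sum_bounded_above[of X "\<lambda>x. card (R `` {x})" n] assms(4) by simp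

lemma card_ge_Domain_mult:
  assumes "finite R" "\<And>x. x \<in> Domain R \<Longrightarrow> n \<le> card (R `` {x})"
  shows "card (Domain R) * n \<le> card R"
  using card_eq_sum_Image[OF assms(1) finite_Domain[OF assms(1)]]
    sum_bounded_below[of "Domain R" n "\<lambda>x. card (R `` {x})"] assms(2) by simp

text \<open>Incidences between grid points (x, y) and lines y = m x + c: two points lie on at most
  one common line. With x, m < q and c < q^2 there are q^4 incidences, at most 2 q^3 points and at
  most q^3 lines, which gives density q / 3 and explains \<open>q = 3 * k\<close>.\<close>

lemma dense_C4_free_exists:
  assumes "k > 0"
  shows "\<exists>Q :: ((nat \<times> nat) \<times> (nat \<times> nat)) set. dense_bip k Q \<and> C4_free Q"
proof -
  define q where "q = 3 * k"
  define g :: "nat \<times> nat \<times> nat \<Rightarrow> (nat \<times> nat) \<times> (nat \<times> nat)" where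
    "g = (\<lambda>(x, m, c). ((x, m * x + c), (m, c)))"
  define B where "B = {..<q} \<times> {..<q} \<times> {..<q^2}"
  define Q where "Q = g ` B"
  have inj: "inj_on g B" by (auto simp: g_def inj_on_def)
  have cQ: "card Q = q ^ 4"
    unfolding Q_def by (subst card_image[OF inj]) (simp add: B_def card_cartesian_product power_numeral_reduce)
  have q: "q > 0" using assms by (simp add: q_def)
  have D: "Domain Q \<subseteq> {..<q} \<times> {..<2*q^2}"
  proof
    fix z assume "z \<in> Domain Q"
    then obtain x m c where z: "z = (x, m*x+c)" "x < q" "m < q" "c < q^2"
      by (auto simp: Q_def g_def B_def)
    have "m * x \<le> q * q" using z by (intro mult_mono) auto
    then show "z \<in> {..<q} \<times> {..<2*q^2}" using z by (auto simp: power2_eq_square)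
  qed
  have R: "Range Q \<subseteq> {..<q} \<times> {..<q^2}" by (auto simp: Q_def g_def B_def)
  have "card (Domain Q) \<le> q * (2*q^2)"
    using card_mono[OF _ D] by (simp add: card_cartesian_product)
  moreover have "card (Range Q) \<le> q * q^2"
    using card_mono[OF _ R] by (simp add: card_cartesian_product)
  ultimately have "card (Domain Q) + card (Range Q) \<le> q * (2*q^2) + q * q^2" by simp
  also have "\<dots> = 3 * q^3" by (simp add: power2_eq_square power3_eq_cube)
  finally have "k * (card (Domain Q) + card (Range Q)) \<le> k * (3 * q^3)" by (rule mult_le_mono2)
  also have "\<dots> = q ^ 4" by (simp add: q_def power_numeral_reduce)
  finally have "k * (card (Domain Q) + card (Range Q)) \<le> card Q" by (simp add: cQ)
  moreover have "finite Q" by (simp add: Q_def B_def)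
  moreover have "Q \<noteq> {}" using cQ q by auto
  moreover have "C4_free Q"
    unfolding C4_free_def
  proof (intro allI impI)
    fix a a' l l' assume Q: "(a, l) \<in> Q" "(a, l') \<in> Q" "(a', l) \<in> Q" "(a', l') \<in> Q"
    obtain x y x' y' m c m' c' where ab: "a = (x, y)" "a' = (x', y')" "l = (m, c)" "l' = (m', c')"
      by (metis surj_pair)
    have eqs: "y = m*x+c" "y = m'*x+c'" "y' = m*x'+c" "y' = m'*x'+c'"
      using Q by (auto simp: ab Q_def g_def)
    have "(int m - int m') * (int x - int x') = 0"
    proof -
      have "int m * int x + int c = int m' * int x + int c'" "int m * int x' + int c = int m' * int x' + int c'"
        using eqs by (metis of_nat_add of_nat_mult)+
      then show ?thesis by algebra
    qed
    then have "m = m' \<or> x = x'" by auto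
    then show "a = a' \<or> l = l'" using eqs by (auto simp: ab)
  qed
  ultimately show ?thesis by (auto simp: dense_bip_def)
qed

lemma Domain_map_prod: "Domain (map_prod f g ` Q) = f ` Domain Q"
  and Range_map_prod: "Range (map_prod f g ` Q) = g ` Range Q"
  by (force simp: map_prod_def)+

lemma C4_free_map_prod:
  assumes "C4_free Q" "inj_on f (Domain Q)" "inj_on g (Range Q)"
  shows "C4_free (map_prod f g ` Q)"
  unfolding C4_free_def
proof (intro allI impI)
  fix x x' y y'
  assume "(x, y) \<in> map_prod f g ` Q" "(x, y') \<in> map_prod f g ` Q"
    "(x', y) \<in> map_prod f g ` Q" "(x', y') \<in> map_prod f g ` Q"
  then obtain a1 b1 a2 b2 a3 b3 a4 b4 where
    "(a1, b1) \<in> Q" "x = f a1" "y = g b1" "(a2, b2) \<in> Q" "x = f a2" "y' = g b2"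
    "(a3, b3) \<in> Q" "x' = f a3" "y = g b3" "(a4, b4) \<in> Q" "x' = f a4" "y' = g b4"
    by (auto simp: map_prod_def image_iff split_beta)
  moreover from this have "a1 = a2" "b1 = b3" "a3 = a4" "b2 = b4"
    by (metis assms inj_onD Domain.DomainI Range.RangeI)+
  ultimately show "x = x' \<or> y = y'" using C4_freeD[OF assms(1)] by metis
qed

lemma dense_bip_map_prod:
  assumes "dense_bip k Q" "inj_on f (Domain Q)" "inj_on g (Range Q)"
  shows "dense_bip k (map_prod f g ` Q)"
proof -
  have "inj_on (map_prod f g) Q"
  proof (rule inj_on_subset)
    show "inj_on (map_prod f g) (Domain Q \<times> Range Q)" using assms by (intro map_prod_inj_on)
  qed auto
  then show ?thesis
    using assms by (simp add: dense_bip_def card_image Domain_map_prod Range_map_prod)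
qed

lemma dense_C4_free_in_set:
  assumes "k > 0"
  shows "\<exists>N. \<forall>I :: 'b set. N \<le> card I \<longrightarrow>
     (\<exists>Q \<subseteq> I \<times> I. dense_bip k Q \<and> C4_free Q \<and> Domain Q \<inter> Range Q = {})"
proof -
  obtain Q :: "((nat \<times> nat) \<times> (nat \<times> nat)) set" where Q: "dense_bip k Q" "C4_free Q"
    using dense_C4_free_exists[OF assms] by blast
  \<comment> \<open>Embedding the disjoint sum keeps the two sides apart inside
    \<open>I\<close>.\<close>
  let ?S = "Domain Q <+> Range Q"
  have fin: "finite ?S" using Q by (auto simp: dense_bip_def finite_Domain finite_Range)
  show ?thesis
  \<comment> \<open>The extra 1 makes \<open>card I\<close> positive, which excludes infinite
    \<open>I\<close>.\<close>
  proof (intro exI[of _ "card ?S + 1"] allI impI)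
    fix I :: "'b set" assume I: "card ?S + 1 \<le> card I"
    then have "finite I" by (metis Suc_eq_plus1 card.infinite not_less_eq_eq zero_le)
    then obtain h where h: "h ` ?S \<subseteq> I" "inj_on h ?S"
      using card_le_inj[OF fin, of I] I by auto
    let ?f = "\<lambda>x. h (Inl x)" and ?g = "\<lambda>x. h (Inr x)"
    have "inj_on ?f (Domain Q)" "inj_on ?g (Range Q)"
      using h(2) by (auto simp: inj_on_def)
    moreover have "map_prod ?f ?g ` Q \<subseteq> I \<times> I" using h(1) by (auto simp: map_prod_def)
    moreover have "Domain (map_prod ?f ?g ` Q) \<inter> Range (map_prod ?f ?g ` Q) = {}"
    proof -
      have "h (Inl a) \<noteq> h (Inr b)" if "a \<in> Domain Q" "b \<in> Range Q" for a b
        using inj_onD[OF h(2), of "Inl a" "Inr b"] that by auto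
      then show ?thesis unfolding Domain_map_prod Range_map_prod by blast
    qed
    ultimately show "\<exists>Q \<subseteq> I \<times> I. dense_bip k Q \<and> C4_free Q \<and> Domain Q \<inter> Range Q = {}"
      using C4_free_map_prod[OF Q(2), of ?f ?g] dense_bip_map_prod[OF Q(1), of ?f ?g]
      by (intro exI[of _ "map_prod ?f ?g ` Q"]) simp
  qed
qed

section \<open>Bipartite graphs with one side much larger than the other\<close>

lemma greedy_transversal:
  assumes "finite Q" "\<And>e. e \<in> Q \<Longrightarrow> card Q \<le> card (S e)"
  shows "\<exists>\<alpha>. inj_on \<alpha> Q \<and> (\<forall>e\<in>Q. \<alpha> e \<in> S e)"
proof -
  have "\<exists>\<alpha>. inj_on \<alpha> P \<and> (\<forall>e\<in>P. \<alpha> e \<in> S e)" if "P \<subseteq> Q" for P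
    using finite_subset[OF that assms(1)] that
  proof (induction P rule: finite_induct)
    case (insert e P)
    then obtain \<alpha> where \<alpha>: "inj_on \<alpha> P" "\<forall>e\<in>P. \<alpha> e \<in> S e" by auto
    \<comment> \<open>Fewer than \<open>card Q\<close> values are taken at any stage, so
      \<open>S e\<close> still offers a new one.\<close>
    have "card (\<alpha> ` P) < card (insert e P)"
      using insert.hyps card_image_le[of P \<alpha>] by simp
    also have "\<dots> \<le> card (S e)"
      using insert.prems assms card_mono[of Q "insert e P"] by (meson insertI1 le_trans subsetD)
    finally have "\<not> S e \<subseteq> \<alpha> ` P"
      using card_mono[of "\<alpha> ` P" "S e"] insert.hyps by auto
    then obtain z where z: "z \<in> S e" "z \<notin> \<alpha> ` P" by blast
    have "inj_on (\<alpha>(e := z)) (insert e P)"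
      using \<alpha>(1) z(2) insert.hyps by (auto simp: inj_on_def)
    moreover have "\<forall>e'\<in>insert e P. (\<alpha>(e := z)) e' \<in> S e'"
      using \<alpha>(2) z(1) by auto
    ultimately show ?case by blast
  qed auto
  then show ?thesis by blast
qed

lemma finite_maximal_subset:
  assumes "finite A" "P {}"
  shows "\<exists>S. S \<subseteq> A \<and> P S \<and> (\<forall>x\<in>A. P (insert x S) \<longrightarrow> x \<in> S)"
proof -
  have "finite {S. S \<subseteq> A \<and> P S}" "{S. S \<subseteq> A \<and> P S} \<noteq> {}" using assms by auto
  from finite_has_maximal[OF this] obtain S where
    S: "S \<subseteq> A" "P S" "\<And>S'. S' \<subseteq> A \<Longrightarrow> P S' \<Longrightarrow> S \<subseteq> S' \<Longrightarrow> S = S'"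
    by auto
  have "x \<in> S" if "x \<in> A" "P (insert x S)" for x
    using S(3)[of "insert x S"] S(1) that by blast
  with S(1,2) show ?thesis by blast
qed

text \<open>A maximal independent set dominates: every element lies in one of its closed
  neighbourhoods, each of size at most \<open>c + 1\<close>.\<close>

lemma bounded_degree_independent:
  assumes "finite A" "symp E" "\<And>x. x \<in> A \<Longrightarrow> card {y \<in> A. E x y} \<le> c"
  shows "\<exists>S \<subseteq> A. (\<forall>x\<in>S. \<forall>y\<in>S. x \<noteq> y \<longrightarrow> \<not> E x y) \<and> card A \<le> (c + 1) * card S"
proof -
  let ?P = "\<lambda>S. \<forall>x\<in>S. \<forall>y\<in>S. x \<noteq> y \<longrightarrow> \<not> E x y"
  have "\<exists>S. S \<subseteq> A \<and> ?P S \<and> (\<forall>x\<in>A. ?P (insert x S) \<longrightarrow> x \<in> S)"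
    by (rule finite_maximal_subset[OF assms(1)]) simp
  then obtain S where S: "S \<subseteq> A \<and> ?P S \<and> (\<forall>x\<in>A. ?P (insert x S) \<longrightarrow> x \<in> S)" by (rule exE)
  have finS: "finite S" using S assms(1) finite_subset by blast
  have "A \<subseteq> (\<Union>x\<in>S. insert x {y \<in> A. E x y})"
  proof
    fix z assume z: "z \<in> A"
    show "z \<in> (\<Union>x\<in>S. insert x {y \<in> A. E x y})"
    proof (cases "z \<in> S")
      case False
      then have "\<not> ?P (insert z S)" using S z by blast
      then obtain x where "x \<in> S" "E x z \<or> E z x" using S by blast
      then show ?thesis using z assms(2) by (auto dest: sympD)
    qed auto
  qed
  then have "card A \<le> card (\<Union>x\<in>S. insert x {y \<in> A. E x y})"
    using finS assms(1) by (intro card_mono) auto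
  also have "\<dots> \<le> (\<Sum>x\<in>S. card (insert x {y \<in> A. E x y}))"
    by (rule card_UN_le[OF finS])
  also have "\<dots> \<le> (\<Sum>x\<in>S. c + 1)"
  proof (rule sum_mono)
    fix x assume "x \<in> S"
    then have "card {y \<in> A. E x y} \<le> c" using assms(3) S by blast
    then show "card (insert x {y \<in> A. E x y}) \<le> c + 1"
      using assms(1) by (simp add: card_insert_if)
  qed
  also have "\<dots> = (c + 1) * card S" by simp
  finally show ?thesis using S by blast
qed

text \<open>Join two right vertices if they have many common neighbours. By Ramsey each left
  neighbourhood contains a large clique or \<open>2 * k\<close> independent vertices. One clique
  suffices for a subdivision: a dense \<open>C4_free\<close> graph is placed on it and the common
  neighbours subdivide its edges. Otherwise every left vertex keeps \<open>2 * k\<close> independent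
  neighbours; it then shares two of them with boundedly many left vertices, and an independent set
  of this conflict relation spans a graph without 4-cycles. The imbalance makes that set at least as
  large as the right side.\<close>

lemma unbalanced_bip:
  assumes "k > 0"
  shows "\<exists>d C. \<forall>R :: ('a \<times> 'b) set. finite R \<longrightarrow> R \<noteq> {} \<longrightarrow> (\<forall>x\<in>Domain R. d \<le> card (R `` {x})) \<longrightarrow>
      C * card (Range R) \<le> card (Domain R) \<longrightarrow>
      (\<exists>Q \<subseteq> R. dense_bip k Q \<and> C4_free Q) \<or> (\<exists>Q. dense_bip k Q \<and> C4_free Q \<and> one_subdivision Q R)"
proof -
  obtain N where N: "\<And>I :: 'b set. N \<le> card I \<Longrightarrow>
      \<exists>Q \<subseteq> I \<times> I. dense_bip k Q \<and> C4_free Q \<and> Domain Q \<inter> Range Q = {}"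
    using dense_C4_free_in_set[OF assms] by blast
  obtain d where "\<forall>(V :: 'b set) E. finite V \<and> d \<le> card V \<longrightarrow>
      (\<exists>I \<subseteq> V. card I = N \<and> clique I E \<or> card I = 2 * k \<and> indep I E)"
    using ramsey2[where ?'a = 'b, of N "2 * k"] by (elim exE conjE) (rule that)
  then have d: "\<exists>I \<subseteq> V. card I = N \<and> clique I E \<or> card I = 2 * k \<and> indep I E"
    if "finite V" "d \<le> card V" for V :: "'b set" and E
    using that by (elim allE impE) (rule conjI)
  \<comment> \<open>A graph \<open>Q\<close> on \<open>N\<close> vertices has at most
    \<open>N * N\<close> edges, so \<open>T\<close> common neighbours per pair allow distinct
    subdividing vertices.\<close>
  define T where "T = N * N"
  \<comment> \<open>At most \<open>(2 * k) * (2 * k)\<close> pairs from \<open>M x\<close>, each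
    with at most \<open>T\<close> common neighbours, bound the conflicts of
    \<open>x\<close>.\<close>
  define c where "c = (2 * k) * (2 * k) * T"
  show ?thesis
  proof (rule exI[of _ d], rule exI[of _ "c + 1"], intro allI impI)
    fix R :: "('a \<times> 'b) set"
    assume fin: "finite R" and ne: "R \<noteq> {}" and deg: "\<forall>x\<in>Domain R. d \<le> card (R `` {x})"
      and unb: "(c + 1) * card (Range R) \<le> card (Domain R)"
    define cod where "cod y y' = {x. (x, y) \<in> R \<and> (x, y') \<in> R}" for y y'
    have fincod: "finite (cod y y')" for y y'
      by (rule finite_subset[OF _ finite_Domain[OF fin]]) (auto simp: cod_def)
    have codsym: "cod y y' = cod y' y" for y y' by (auto simp: cod_def)
    define E where "E = {{y, y'} | y y'. T \<le> card (cod y y')}"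
    have E: "{y, y'} \<in> E \<longleftrightarrow> T \<le> card (cod y y')" for y y'
      unfolding E_def using codsym by (auto simp: doubleton_eq_iff)
    show "(\<exists>Q \<subseteq> R. dense_bip k Q \<and> C4_free Q) \<or> (\<exists>Q. dense_bip k Q \<and> C4_free Q \<and> one_subdivision Q R)"
    proof (cases "\<exists>x\<in>Domain R. \<exists>I \<subseteq> R `` {x}. card I = N \<and> clique I E")
      case True
      then obtain I where I: "card I = N" "clique I E" "I \<subseteq> Range R" by auto
      have finI: "finite I" using I(3) fin finite_Range finite_subset by blast
      obtain Q where Q: "Q \<subseteq> I \<times> I" "dense_bip k Q" "C4_free Q" "Domain Q \<inter> Range Q = {}"
        using N[of I] I(1) by auto
      have "card Q \<le> T"
        using card_mono[OF _ Q(1)] finI I(1) by (simp add: T_def card_cartesian_product)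
      moreover have "T \<le> card (cod (fst e) (snd e))" if "e \<in> Q" for e
      proof -
        have "fst e \<in> I" "snd e \<in> I" using that Q(1) by auto
        moreover have "fst e \<noteq> snd e"
          using that Q(4) by (metis Domain.DomainI IntI Range.RangeI empty_iff prod.collapse)
        ultimately show ?thesis using I(2) E unfolding clique_def by blast
      qed
      ultimately obtain \<alpha> where "inj_on \<alpha> Q" "\<forall>e\<in>Q. \<alpha> e \<in> cod (fst e) (snd e)"
        using greedy_transversal[of Q "\<lambda>e. cod (fst e) (snd e)"] Q(2) unfolding dense_bip_def
        by (meson le_trans)
      then have "one_subdivision Q R"
        unfolding one_subdivision_def using Q(4) by (fastforce simp: cod_def)
      then show ?thesis using Q by blast
    next
      case False
      have "\<exists>I \<subseteq> R `` {x}. card I = 2 * k \<and> indep I E" if "x \<in> Domain R" for x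
        using d[of "R `` {x}" E] False deg that fin by (meson finite_Image)
      then obtain M where M: "\<And>x. x \<in> Domain R \<Longrightarrow> M x \<subseteq> R `` {x}"
        "\<And>x. x \<in> Domain R \<Longrightarrow> card (M x) = 2 * k" "\<And>x. x \<in> Domain R \<Longrightarrow> indep (M x) E" by metis
      have finM: "finite (M x)" if "x \<in> Domain R" for x
        using M(2)[OF that] assms by (metis card.infinite mult_pos_pos not_gr_zero zero_less_numeral)
      define conf where "conf x x' \<longleftrightarrow> (\<exists>y y'. y \<noteq> y' \<and> y \<in> M x \<and> y' \<in> M x \<and> y \<in> M x' \<and> y' \<in> M x')" for x x'
      have "symp conf" unfolding conf_def by (auto simp: symp_def)
      moreover have "card {x' \<in> Domain R. conf x x'} \<le> c" if x: "x \<in> Domain R" for x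
      proof -
        let ?P = "{e \<in> M x \<times> M x. fst e \<noteq> snd e}"
        have finP: "finite ?P" using finM[OF x] by auto
        have "card ?P \<le> card (M x \<times> M x)" using finM[OF x] by (intro card_mono) auto
        then have cP: "card ?P \<le> (2 * k) * (2 * k)" using M(2)[OF x] by (simp add: card_cartesian_product)
        have "{x' \<in> Domain R. conf x x'} \<subseteq> (\<Union>e\<in>?P. cod (fst e) (snd e))"
          using M(1) by (fastforce simp: conf_def cod_def)
        then have "card {x' \<in> Domain R. conf x x'} \<le> card (\<Union>e\<in>?P. cod (fst e) (snd e))"
          using finP fincod by (intro card_mono) auto
        also have "\<dots> \<le> (\<Sum>e\<in>?P. card (cod (fst e) (snd e)))" by (rule card_UN_le[OF finP])
        also have "\<dots> \<le> (\<Sum>e\<in>?P. T)"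
        proof (rule sum_mono)
          fix e assume "e \<in> ?P"
          then have "{fst e, snd e} \<notin> E" using M(3)[OF x] by (auto simp: indep_def)
          then show "card (cod (fst e) (snd e)) \<le> T" using E by auto
        qed
        also have "\<dots> \<le> c" using cP by (simp add: c_def)
        finally show ?thesis .
      qed
      ultimately obtain A where A: "A \<subseteq> Domain R" "\<forall>x\<in>A. \<forall>y\<in>A. x \<noteq> y \<longrightarrow> \<not> conf x y"
        "card (Domain R) \<le> (c + 1) * card A"
        using bounded_degree_independent[OF finite_Domain[OF fin], of conf c] by blast
      define Q where "Q = (SIGMA x:A. M x)"
      have finA: "finite A" using A(1) fin finite_Domain finite_subset by blast
      have QR: "Q \<subseteq> R" using A(1) M(1) by (fastforce simp: Q_def)
      have "card Q = (\<Sum>x\<in>A. card (M x))"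
        unfolding Q_def using A(1) finM finA by (intro card_SigmaI) auto
      also have "\<dots> = (\<Sum>x\<in>A. 2 * k)" using A(1) M(2) by (intro sum.cong) auto
      finally have cQ: "card Q = card A * (2 * k)" by simp
      have DQ: "Domain Q \<subseteq> A" by (auto simp: Q_def)
      have "(c + 1) * card (Range R) \<le> (c + 1) * card A" using unb A(3) by linarith
      then have "card (Range R) \<le> card A" by (metis Suc_eq_plus1 Suc_mult_le_cancel1)
      moreover have "card (Range Q) \<le> card (Range R)"
        using QR fin by (intro card_mono finite_Range) auto
      moreover have "card (Domain Q) \<le> card A" using DQ finA by (rule card_mono[rotated])
      ultimately have "card (Domain Q) + card (Range Q) \<le> 2 * card A" by linarith
      then have "k * (card (Domain Q) + card (Range Q)) \<le> k * (2 * card A)" by (rule mult_le_mono2)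
      then have "k * (card (Domain Q) + card (Range Q)) \<le> card Q" by (simp add: cQ mult_ac)
      moreover have "Q \<noteq> {}"
      proof -
        have "card (Domain R) > 0" using ne fin by (simp add: card_gt_0_iff finite_Domain Domain_empty_iff)
        then have "card A > 0" using A(3) by (metis gr0I leD mult_0_right)
        then show ?thesis using cQ assms by (metis card.empty mult_eq_0_iff not_gr_zero zero_neq_numeral)
      qed
      moreover have "C4_free Q"
        using A(2) by (auto simp: C4_free_def Q_def conf_def)
      ultimately have "dense_bip k Q \<and> C4_free Q"
        using finite_subset[OF QR fin] by (auto simp: dense_bip_def)
      then show ?thesis using QR by blast
    qed
  qed
qed

text \<open>Take \<open>S\<close> maximal among the \<open>C4_free\<close> subsets with all degrees
  at most \<open>q\<close>. An edge that cannot be added has a saturated end or closes a 4-cycle.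
  Each side has at most \<open>card S / q\<close> saturated vertices, each on at most \<Delta>
  edges, and each edge of \<open>S\<close> is the middle of at most \<open>q^2\<close> paths of
  three edges.\<close>

lemma greedy_C4_free:
  assumes fin: "finite R" and dx: "\<And>x. card (R `` {x}) \<le> \<Delta>" and dy: "\<And>y. card (R\<inverse> `` {y}) \<le> \<Delta>"
    and q: "q > 0"
  shows "\<exists>S \<subseteq> R. C4_free S \<and> q * card R \<le> card S * (q + q ^ 3 + 2 * \<Delta>)"
proof -
  let ?P = "\<lambda>S. C4_free S \<and> (\<forall>x. card (S `` {x}) \<le> q) \<and> (\<forall>y. card (S\<inverse> `` {y}) \<le> q)"
  have "\<exists>S. S \<subseteq> R \<and> ?P S \<and> (\<forall>e\<in>R. ?P (insert e S) \<longrightarrow> e \<in> S)"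
    by (rule finite_maximal_subset[OF fin]) (simp add: C4_free_def)
  then obtain S where S: "S \<subseteq> R \<and> ?P S \<and> (\<forall>e\<in>R. ?P (insert e S) \<longrightarrow> e \<in> S)" by (rule exE)
  have finS: "finite S" using S fin finite_subset by blast
  define X where "X = {x \<in> Domain R. q \<le> card (S `` {x})}"
  define Y where "Y = {y \<in> Range R. q \<le> card (S\<inverse> `` {y})}"
  define RX where "RX = {e \<in> R. fst e \<in> X}"
  define RY where "RY = {e \<in> R. snd e \<in> Y}"
  \<comment> \<open>Pairs joined by three edges of \<open>S\<close>, indexed by the middle edge:
    adding one of them would close a 4-cycle.\<close>
  define W where "W = (\<Union>e\<in>S. (S\<inverse> `` {snd e}) \<times> (S `` {fst e}))"
  have "R \<subseteq> S \<union> RX \<union> RY \<union> W"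
  proof
    fix e assume e: "e \<in> R"
    obtain x y where xy: "e = (x, y)" by (cases e)
    show "e \<in> S \<union> RX \<union> RY \<union> W"
    proof (rule ccontr)
      assume not: "e \<notin> S \<union> RX \<union> RY \<union> W"
      have "card (S `` {x}) < q"
      proof (rule ccontr)
        assume "\<not> card (S `` {x}) < q"
        then have "x \<in> X" using e xy by (auto simp: X_def)
        then show False using not e xy by (auto simp: RX_def)
      qed
      moreover have "card (S\<inverse> `` {y}) < q"
      proof (rule ccontr)
        assume "\<not> card (S\<inverse> `` {y}) < q"
        then have "y \<in> Y" using e xy by (auto simp: Y_def)
        then show False using not e xy by (auto simp: RY_def)
      qed
      moreover have "card (insert e S `` {x'}) \<le> (if x' = x then Suc (card (S `` {x'})) else card (S `` {x'}))" for x'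
      proof -
        have "insert e S `` {x'} = (if x' = x then insert y (S `` {x'}) else S `` {x'})" by (auto simp: xy)
        then show ?thesis using finS by (simp add: card_insert_if)
      qed
      moreover have "card ((insert e S)\<inverse> `` {y'}) \<le> (if y' = y then Suc (card (S\<inverse> `` {y'})) else card (S\<inverse> `` {y'}))" for y'
      proof -
        have "(insert e S)\<inverse> `` {y'} = (if y' = y then insert x (S\<inverse> `` {y'}) else S\<inverse> `` {y'})" by (auto simp: xy)
        then show ?thesis using finS by (simp add: card_insert_if)
      qed
      ultimately have "(\<forall>x. card (insert e S `` {x}) \<le> q) \<and> (\<forall>y. card ((insert e S)\<inverse> `` {y}) \<le> q)"
        using S by (smt (verit, best) Suc_leI le_trans)
      moreover have "C4_free (insert e S)"
      proof -
        have "\<not> ((x, v) \<in> S \<and> (u, y) \<in> S \<and> (u, v) \<in> S)" for u v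
          using not by (auto simp: W_def xy)
        moreover have "C4_free S" using S by blast
        ultimately show ?thesis unfolding C4_free_def xy by auto
      qed
      ultimately show False using S e not by blast
    qed
  qed
  then have "card R \<le> card (S \<union> RX \<union> RY \<union> W)"
    using finS fin by (intro card_mono) (auto simp: RX_def RY_def W_def)
  also have "\<dots> \<le> card S + card RX + card RY + card W"
    by (meson card_Un_le add_mono le_refl le_trans)
  finally have cR: "card R \<le> card S + card RX + card RY + card W" .
  have "card W \<le> (\<Sum>e\<in>S. card ((S\<inverse> `` {snd e}) \<times> (S `` {fst e})))"
    unfolding W_def by (rule card_UN_le[OF finS])
  also have "\<dots> \<le> (\<Sum>e\<in>S. q * q)"
    using S by (intro sum_mono) (auto simp: card_cartesian_product intro: mult_mono)
  finally have cW: "card W \<le> card S * (q * q)" by simp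
  have finXY: "finite X" "finite Y" using fin by (auto simp: X_def Y_def finite_Domain finite_Range)
  have "q * card X = (\<Sum>x\<in>X. q)" by simp
  also have "\<dots> \<le> (\<Sum>x\<in>X. card (S `` {x}))" by (intro sum_mono) (auto simp: X_def)
  also have "\<dots> \<le> (\<Sum>x\<in>Domain R. card (S `` {x}))"
    using fin by (intro sum_mono2) (auto simp: X_def finite_Domain)
  also have "\<dots> = card S" using card_eq_sum_Image[of S "Domain R"] finS fin S by (simp add: finite_Domain Domain_mono)
  finally have cX: "q * card X \<le> card S" .
  have "q * card Y = (\<Sum>x\<in>Y. q)" by simp
  also have "\<dots> \<le> (\<Sum>x\<in>Y. card (S\<inverse> `` {x}))" by (intro sum_mono) (auto simp: Y_def)
  also have "\<dots> \<le> (\<Sum>x\<in>Range R. card (S\<inverse> `` {x}))"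
    using fin by (intro sum_mono2) (auto simp: Y_def finite_Range)
  also have "\<dots> = card S" using card_eq_sum_Image[of "S\<inverse>" "Range R"] finS fin S by (simp add: finite_Range Range_mono)
  finally have cY: "q * card Y \<le> card S" .
  have "card RX \<le> card X * \<Delta>"
  proof (rule card_le_Domain_mult)
    show "card (RX `` {x}) \<le> \<Delta>" for x
      using card_mono[of "R `` {x}" "RX `` {x}"] dx[of x] fin by (force simp: RX_def)
  qed (use fin finXY in \<open>auto simp: RX_def\<close>)
  then have "q * card RX \<le> (q * card X) * \<Delta>" by (metis mult.assoc mult_le_mono2)
  then have cRX: "q * card RX \<le> card S * \<Delta>" using cX by (meson le_trans mult_le_mono1)
  have "card (RY\<inverse>) \<le> card Y * \<Delta>"
  proof (rule card_le_Domain_mult)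
    show "card (RY\<inverse> `` {x}) \<le> \<Delta>" for x
      using card_mono[of "R\<inverse> `` {x}" "RY\<inverse> `` {x}"] dy[of x] fin by (force simp: RY_def)
  qed (use fin finXY in \<open>auto simp: RY_def\<close>)
  then have "q * card RY \<le> (q * card Y) * \<Delta>" by (simp add: mult.assoc)
  then have cRY: "q * card RY \<le> card S * \<Delta>" using cY by (meson le_trans mult_le_mono1)
  have "q * card R \<le> q * (card S + card RX + card RY + card W)" using cR by (rule mult_le_mono2)
  also have "\<dots> = q * card S + q * card RX + q * card RY + q * card W" by (simp add: algebra_simps)
  also have "\<dots> \<le> q * card S + card S * \<Delta> + card S * \<Delta> + q * (card S * (q * q))"
    using cRX cRY cW by (intro add_mono mult_le_mono2) auto
  also have "\<dots> = card S * (q + q ^ 3 + 2 * \<Delta>)" by (simp add: algebra_simps power3_eq_cube)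
  finally show ?thesis using S by blast
qed

section \<open>Densest subgraphs and the general bipartite graph\<close>

definition nverts :: "('a \<times> 'b) set \<Rightarrow> real" where
  "nverts R = real (card (Domain R) + card (Range R))"

lemma nverts_converse [simp]: "nverts (R\<inverse>) = nverts R"
  by (simp add: nverts_def)

lemma nverts_pos: "finite R \<Longrightarrow> R \<noteq> {} \<Longrightarrow> 0 < nverts R"
  unfolding nverts_def of_nat_0_less_iff
  by (intro add_pos_nonneg) (simp_all add: card_gt_0_iff finite_Domain Domain_empty_iff)

lemma nverts_mono:
  assumes "S \<subseteq> R" "finite R" shows "nverts S \<le> nverts R"
  unfolding nverts_def of_nat_le_iff
  using assms by (intro add_mono card_mono Domain_mono Range_mono) (auto simp: finite_Domain finite_Range)

text \<open>Passing to a densest subset turns edge counts into vertex counts: any part with a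
  constant fraction of its edges must span a constant fraction of its vertices.\<close>

lemma max_density_subset:
  assumes "finite R" "R \<noteq> {}"
  shows "\<exists>S \<delta>. S \<subseteq> R \<and> S \<noteq> {} \<and> real (card R) \<le> \<delta> * nverts R \<and> real (card S) = \<delta> * nverts S \<and>
           (\<forall>T \<subseteq> S. real (card T) \<le> \<delta> * nverts T)"
proof -
  let ?d = "\<lambda>S. real (card S) / nverts S"
  let ?F = "{S. S \<subseteq> R \<and> S \<noteq> {}}"
  have F: "finite ?F" "?F \<noteq> {}" using assms by auto
  then have "Max (?d ` ?F) \<in> ?d ` ?F" by (intro Max_in) auto
  then obtain S where S1: "S \<in> ?F" and max: "Max (?d ` ?F) = ?d S" by (metis (no_types, lifting) imageE)
  have S2: "?d T \<le> ?d S" if "T \<in> ?F" for T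
    unfolding max[symmetric] using F(1) that by (intro Max_ge) auto
  note S = S1 S2
  have pos: "0 < nverts T" if "T \<in> ?F" for T
    using that assms nverts_pos finite_subset by blast
  have le: "real (card T) \<le> ?d S * nverts T" if "T \<subseteq> R" for T
  proof (cases "T = {}")
    case False
    then show ?thesis using S(2)[of T] pos[of T] that by (simp add: divide_le_eq)
  qed (simp add: nverts_def)
  have "real (card S) = ?d S * nverts S" using pos[OF S(1)] by simp
  then show ?thesis using S(1) le by (intro exI[of _ S] exI[of _ "?d S"]) auto
qed

text \<open>Dropping the left vertices of degree below \<open>d\<close> costs at most \<delta> n / 8
  edges, with n for \<open>nverts S\<close>. The \<delta> n / 8 edges that remain span at least n /
  8 vertices by maximal density. At most n / 16 of these are on the right, so at least n / 16 are on
  the left.\<close>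

lemma unbalanced_subset:
  assumes fin: "finite S" and dens: "\<And>T. T \<subseteq> S \<Longrightarrow> real (card T) \<le> \<delta> * nverts T"
    and T: "T \<subseteq> S" "real (card T) \<ge> \<delta> * nverts S / 4"
    and K: "K * real (card (Range T)) \<le> nverts S" "K \<ge> 16" "K \<ge> 16 * real C"
    and \<delta>: "\<delta> \<ge> 8 * real d" "\<delta> > 0" and ne: "S \<noteq> {}"
  shows "\<exists>T' \<subseteq> S. T' \<noteq> {} \<and> (\<forall>x\<in>Domain T'. d \<le> card (T' `` {x})) \<and> C * card (Range T') \<le> card (Domain T')"
proof -
  have finT: "finite T" using T fin finite_subset by blast
  have n: "0 < nverts S" using fin ne by (rule nverts_pos)
  define T' where "T' = {e \<in> T. d \<le> card (T `` {fst e})}"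
  have T'T: "T' \<subseteq> T" by (auto simp: T'_def)
  then have T'S: "T' \<subseteq> S" using T by blast
  have "card (T - T') \<le> card (Domain T) * d"
  proof (rule card_le_Domain_mult)
    show "card ((T - T') `` {x}) \<le> d" for x
    proof (cases "d \<le> card (T `` {x})")
      case True
      then have "(T - T') `` {x} = {}" by (auto simp: T'_def)
      then show ?thesis by simp
    next
      case False
      then show ?thesis using card_mono[of "T `` {x}" "(T - T') `` {x}"] finT
        by (meson Diff_subset Image_mono finite_Image le_trans nat_le_linear order_refl)
    qed
  qed (use finT in \<open>auto simp: finite_Domain\<close>)
  moreover have "card (Domain T) \<le> card (Domain S)"
    using T(1) fin by (intro card_mono Domain_mono) (auto simp: finite_Domain)
  ultimately have "card (T - T') \<le> card (Domain S) * d" by (meson le_trans mult_le_mono1)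
  then have "real (card (T - T')) \<le> real (card (Domain S)) * real d"
    by (metis of_nat_le_iff of_nat_mult)
  also have "\<dots> \<le> nverts S * (\<delta> / 8)"
    using \<delta>(1) n by (intro mult_mono) (auto simp: nverts_def)
  finally have "real (card (T - T')) \<le> \<delta> * nverts S / 8" by (simp add: mult.commute)
  moreover have "card T = card T' + card (T - T')"
    using card_Un_disjoint[of T' "T - T'"] T'T finT finite_subset[OF T'T finT] by (simp add: Un_absorb1)
  ultimately have cT': "real (card T') \<ge> \<delta> * nverts S / 8" using T(2) by simp
  then have T'ne: "T' \<noteq> {}" using n \<delta>(2) by (auto simp: mult_le_0_iff)
  have "\<delta> * (nverts S / 8) \<le> \<delta> * nverts T'" using dens[OF T'S] cT' by simp
  then have "nverts S / 8 \<le> nverts T'" using \<delta>(2) by simp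
  moreover have "card (Range T') \<le> card (Range T)"
    using T'T finT by (intro card_mono Range_mono) (auto simp: finite_Range)
  ultimately have 1: "nverts S \<le> 8 * real (card (Domain T')) + 8 * real (card (Range T))"
    by (simp add: nverts_def)
  have "16 * real (card (Range T)) \<le> K * real (card (Range T))"
    using K(2) by (intro mult_right_mono) auto
  then have "nverts S \<le> 16 * real (card (Domain T'))" using 1 K(1) by linarith
  moreover have "16 * real C * real (card (Range T)) \<le> K * real (card (Range T))"
    using K(3) by (intro mult_right_mono) auto
  ultimately have "real C * real (card (Range T)) \<le> real (card (Domain T'))" using K(1) by linarith
  then have "C * card (Range T) \<le> card (Domain T')" by (metis of_nat_le_iff of_nat_mult)
  then have "C * card (Range T') \<le> card (Domain T')"
    using \<open>card (Range T') \<le> card (Range T)\<close> by (meson le_trans mult_le_mono2)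
  moreover have "\<forall>x\<in>Domain T'. d \<le> card (T' `` {x})"
  proof
    fix x assume "x \<in> Domain T'"
    then have "d \<le> card (T `` {x})" by (auto simp: T'_def)
    moreover from this have "T' `` {x} = T `` {x}" by (auto simp: T'_def)
    ultimately show "d \<le> card (T' `` {x})" by simp
  qed
  ultimately show ?thesis using T'S T'ne by blast
qed

text \<open>The subdivision alternative doubles the length of the paths, so sketches at several distance scales are needed.\<close>
theorem dense_imp_C4_free_or_subdivision:
  assumes k: "k > 0"
  shows "\<exists>D. \<forall>R :: ('a \<times> 'a) set. dense_bip D R \<longrightarrow>
      (\<exists>Q. dense_bip k Q \<and> C4_free Q \<and> (Q \<subseteq> R \<or> Q \<subseteq> R\<inverse> \<or> one_subdivision Q R \<or> one_subdivision Q (R\<inverse>)))"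
proof -
  obtain d C where dC: "\<And>R :: ('a \<times> 'a) set. finite R \<Longrightarrow> R \<noteq> {} \<Longrightarrow> (\<forall>x\<in>Domain R. d \<le> card (R `` {x})) \<Longrightarrow>
      C * card (Range R) \<le> card (Domain R) \<Longrightarrow>
      (\<exists>Q \<subseteq> R. dense_bip k Q \<and> C4_free Q) \<or> (\<exists>Q. dense_bip k Q \<and> C4_free Q \<and> one_subdivision Q R)"
    using unbalanced_bip[OF k, where 'a = 'a and 'b = 'a] by metis
  define K where "K = 16 * (C + 1)"
  \<comment> \<open>A quarter of the \<delta> n edges makes the left side of the greedy bound at
    least 4 k K \<delta> n, while its right side stays below 3 k K \<delta> n if fewer than k n
    edges are chosen.\<close>
  define q where "q = 16 * k * K"
  \<comment> \<open>Density \<open>8 * d\<close> pays for dropping low degrees; density above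
    \<open>q + q ^ 3\<close> lets K \<delta> absorb these terms of the greedy bound.\<close>
  define D where "D = max (8 * d) (q + q ^ 3 + 1)"
  have Kpos: "K > 0" "q > 0" using k by (auto simp: K_def q_def)
  show ?thesis
  proof (intro exI[of _ D] allI impI)
    fix R :: "('a \<times> 'a) set" assume R: "dense_bip D R"
    then have finR: "finite R" "R \<noteq> {}" by (auto simp: dense_bip_def)
    obtain S \<delta> where S: "S \<subseteq> R" "S \<noteq> {}" "real (card R) \<le> \<delta> * nverts R" "real (card S) = \<delta> * nverts S"
      and dens: "\<And>T. T \<subseteq> S \<Longrightarrow> real (card T) \<le> \<delta> * nverts T"
      using max_density_subset[OF finR] by blast
    have finS: "finite S" using S(1) finR(1) finite_subset by blast
    have n: "0 < nverts S" using finS S(2) by (rule nverts_pos)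
    have "real D * nverts R \<le> \<delta> * nverts R"
      using R S(3) unfolding dense_bip_def nverts_def by (smt (verit) of_nat_le_iff of_nat_mult)
    then have \<delta>D: "real D \<le> \<delta>" using nverts_pos[OF finR] by simp
    have "real (8 * d) \<le> real D" "real (q + q ^ 3 + 1) \<le> real D" unfolding of_nat_le_iff by (simp_all add: D_def)
    then have \<delta>: "8 * real d \<le> \<delta>" "real (q + q ^ 3) < \<delta>" using \<delta>D by simp_all
    have "0 < \<delta>" using \<delta>(2) by (meson le_less_trans of_nat_0_le_iff)
    note \<delta> = \<delta> this
    \<comment> \<open>Vertices of degree above K times the density: as \<open>S\<close> has \<delta>
      n edges, at most n / K of them lie on each side.\<close>
    define X where "X = {x \<in> Domain S. K * \<delta> < card (S `` {x})}"
    define Y where "Y = {y \<in> Range S. K * \<delta> < card (S\<inverse> `` {y})}"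
    have fXY: "finite X" "finite Y" using finS by (auto simp: X_def Y_def finite_Domain finite_Range)
    have few: "real K * real (card Z) \<le> nverts S"
      if "finite V" "Domain U \<subseteq> V" "finite U" "card U = card S" "Z \<subseteq> V" "\<And>z. z \<in> Z \<Longrightarrow> K * \<delta> < card (U `` {z})"
      for Z V and U :: "('a \<times> 'a) set"
    proof -
      have "(K * \<delta>) * card Z = (\<Sum>z\<in>Z. K * \<delta>)" by simp
      also have "\<dots> \<le> (\<Sum>z\<in>Z. real (card (U `` {z})))" using that(6) by (intro sum_mono) force
      also have "\<dots> \<le> (\<Sum>z\<in>V. real (card (U `` {z})))" using that by (intro sum_mono2) auto
      also have "\<dots> = real (card U)" using card_eq_sum_Image[OF that(3,1,2)] by simp
      also have "\<dots> = \<delta> * nverts S" using that(4) S(4) by simp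
      finally have "\<delta> * (K * card Z) \<le> \<delta> * nverts S" by (simp add: mult_ac)
      then show ?thesis using \<delta>(3) by simp
    qed
    have cX: "real K * real (card X) \<le> nverts S"
      by (rule few[of "Domain S" S]) (use finS in \<open>auto simp: X_def finite_Domain\<close>)
    have cY: "real K * real (card Y) \<le> nverts S"
      by (rule few[of "Range S" "S\<inverse>"]) (use finS in \<open>auto simp: Y_def finite_Range\<close>)
    define Shh where "Shh = {e \<in> S. fst e \<in> X \<and> snd e \<in> Y}"
    define Slh where "Slh = {e \<in> S. fst e \<notin> X \<and> snd e \<in> Y}"
    define Shl where "Shl = {e \<in> S. fst e \<in> X \<and> snd e \<notin> Y}"
    define Sll where "Sll = {e \<in> S. fst e \<notin> X \<and> snd e \<notin> Y}"
    have S_eq: "S = Shh \<union> Slh \<union> Shl \<union> Sll" by (auto simp: Shh_def Slh_def Shl_def Sll_def)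
    have "card S \<le> card Shh + card Slh + card Shl + card Sll"
      unfolding S_eq using card_Un_le[of "Shh \<union> Slh \<union> Shl" Sll] card_Un_le[of "Shh \<union> Slh" Shl]
        card_Un_le[of Shh Slh] by linarith
    then have cS: "\<delta> * nverts S \<le> real (card Shh) + card Slh + card Shl + card Sll" using S(4) by linarith
    have K16: "16 \<le> real K" "16 * real C \<le> real K" by (auto simp: K_def)
    \<comment> \<open>Edges with two high ends span at most n / 8 vertices, so maximal density
      leaves them an eighth of the edges.\<close>
    have "real (card Shh) \<le> \<delta> * nverts S / 8"
    proof -
      have "card (Domain Shh) \<le> card X" "card (Range Shh) \<le> card Y"
        using fXY by (auto intro!: card_mono simp: Shh_def)
      then have "nverts Shh \<le> real (card X) + real (card Y)" by (simp add: nverts_def)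
      moreover have "16 * real (card X) \<le> real K * card X" "16 * real (card Y) \<le> real K * card Y"
        using K16 by (auto intro: mult_right_mono)
      ultimately have "nverts Shh \<le> nverts S / 8" using cX cY by linarith
      then have "\<delta> * nverts Shh \<le> \<delta> * (nverts S / 8)" using \<delta>(3) by simp
      then show ?thesis using dens[of Shh] by (simp add: Shh_def)
    qed
    moreover have "0 < \<delta> * nverts S" using \<delta>(3) n by simp
    \<comment> \<open>As 1/8 + 3/4 < 1, one of the other three classes holds a quarter of the
      edges.\<close>
    ultimately consider "\<delta> * nverts S / 4 \<le> card Slh" | "\<delta> * nverts S / 4 \<le> card Shl" | "\<delta> * nverts S / 4 \<le> card Sll"
      using cS by argo
    \<comment> \<open>A mixed class has few vertices on its high side and leads to the unbalanced
      case, directly or for the converse relation. In the low class all degrees are at most K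
      \<delta>, which suits the greedy choice.\<close>
    then show "\<exists>Q. dense_bip k Q \<and> C4_free Q \<and> (Q \<subseteq> R \<or> Q \<subseteq> R\<inverse> \<or> one_subdivision Q R \<or> one_subdivision Q (R\<inverse>))"
    proof cases
      case 1
      have "card (Range Slh) \<le> card Y" using fXY by (intro card_mono) (auto simp: Slh_def)
      then have "real K * card (Range Slh) \<le> real K * card Y" by (intro mult_left_mono) auto
      then have "real K * card (Range Slh) \<le> nverts S" using cY by linarith
      then obtain T where T: "T \<subseteq> S" "T \<noteq> {}" "\<forall>x\<in>Domain T. d \<le> card (T `` {x})" "C * card (Range T) \<le> card (Domain T)"
        using unbalanced_subset[OF finS dens _ 1 _ K16 \<delta>(1,3) S(2)] by (auto simp: Slh_def)
      have "one_subdivision Q R" if "one_subdivision Q T" for Q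
        using that T(1) S(1) unfolding one_subdivision_def by blast
      then show ?thesis using dC[OF _ T(2-4)] finite_subset[OF T(1) finS] T(1) S(1) by blast
    next
      case 2
      have "card (Domain Shl) \<le> card X" using fXY by (intro card_mono) (auto simp: Shl_def)
      then have "real K * card (Domain Shl) \<le> real K * card X" by (intro mult_left_mono) auto
      then have "real K * card (Range (Shl\<inverse>)) \<le> nverts (S\<inverse>)" using cX by simp
      moreover have "real (card T) \<le> \<delta> * nverts T" if "T \<subseteq> S\<inverse>" for T
        using dens[of "T\<inverse>"] that by (metis card_inverse converse_converse converse_mono nverts_converse)
      ultimately obtain T where T: "T \<subseteq> S\<inverse>" "T \<noteq> {}" "\<forall>x\<in>Domain T. d \<le> card (T `` {x})" "C * card (Range T) \<le> card (Domain T)"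
        using unbalanced_subset[of "S\<inverse>" \<delta> "Shl\<inverse>", OF _ _ _ _ _ K16 \<delta>(1,3)] 2 finS S(2) by (auto simp: Shl_def)
      have TR: "T \<subseteq> R\<inverse>" using T(1) S(1) by blast
      have "one_subdivision Q (R\<inverse>)" if "one_subdivision Q T" for Q
        using that TR unfolding one_subdivision_def by blast
      moreover have "finite T" using finite_subset[OF T(1)] finS by simp
      ultimately show ?thesis using dC[OF _ T(2-4)] TR by blast
    next
      case 3
      define \<Delta> where "\<Delta> = nat \<lfloor>K * \<delta>\<rfloor>"
      have low: "m \<le> \<Delta>" if "real m \<le> K * \<delta>" for m using that by (simp add: \<Delta>_def le_nat_floor)
      have "card (Sll `` {x}) \<le> \<Delta>" for x
      proof (cases "x \<in> Domain Sll")
        case True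
        then have "real (card (S `` {x})) \<le> K * \<delta>" by (auto simp: Sll_def X_def)
        moreover have "card (Sll `` {x}) \<le> card (S `` {x})" using finS by (intro card_mono) (auto simp: Sll_def)
        ultimately show ?thesis using low by simp
      next
        case False
        then have "Sll `` {x} = {}" by blast
        then show ?thesis by simp
      qed
      moreover have "card (Sll\<inverse> `` {x}) \<le> \<Delta>" for x
      proof (cases "x \<in> Range Sll")
        case True
        then have "real (card (S\<inverse> `` {x})) \<le> K * \<delta>" by (auto simp: Sll_def Y_def)
        moreover have "card (Sll\<inverse> `` {x}) \<le> card (S\<inverse> `` {x})" using finS by (intro card_mono) (auto simp: Sll_def)
        ultimately show ?thesis using low by simp
      next
        case False
        then have "Sll\<inverse> `` {x} = {}" by blast
        then show ?thesis by simp
      qed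
      ultimately obtain Q where Q: "Q \<subseteq> Sll" "C4_free Q" "q * card Sll \<le> card Q * (q + q ^ 3 + 2 * \<Delta>)"
        using greedy_C4_free[of Sll \<Delta> q] finS Kpos by (auto simp: Sll_def)
      have QS: "Q \<subseteq> S" using Q(1) by (auto simp: Sll_def)
      have cQ: "k * nverts S \<le> card Q"
      proof (rule ccontr)
        assume "\<not> k * nverts S \<le> card Q"
        then have lt: "real (card Q) \<le> k * nverts S" by simp
        have "real \<Delta> \<le> K * \<delta>" using \<delta>(3) by (simp add: \<Delta>_def)
        have "q * (\<delta> * nverts S / 4) \<le> q * real (card Sll)" using 3 by (intro mult_left_mono) auto
        also have "\<dots> \<le> card Q * real (q + q ^ 3 + 2 * \<Delta>)" using Q(3) by (metis of_nat_le_iff of_nat_mult)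
        also have "\<dots> \<le> (k * nverts S) * (real (q + q ^ 3) + 2 * (K * \<delta>))"
          using lt \<open>real \<Delta> \<le> K * \<delta>\<close> by (intro mult_mono) auto
        also have "\<dots> < (k * nverts S) * (\<delta> + 2 * (K * \<delta>))"
          using \<delta>(2) n k by (intro mult_strict_left_mono) auto
        also have "\<dots> \<le> (k * nverts S) * (K * \<delta> + 2 * (K * \<delta>))"
          using \<delta>(3) n K16 by (intro mult_left_mono add_right_mono) auto
        finally have "16 * k * K * (\<delta> * nverts S / 4) < 3 * (k * K * (\<delta> * nverts S))" by (simp add: q_def mult_ac)
        moreover have "0 \<le> k * K * (\<delta> * nverts S)" using n \<delta>(3) by simp
        ultimately show False by (simp add: mult_ac)
      qed
      moreover have "nverts Q \<le> nverts S" using nverts_mono[OF QS finS] .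
      ultimately have "real k * nverts Q \<le> card Q" by (meson le_trans mult_left_mono of_nat_0_le_iff order_trans)
      then have "k * (card (Domain Q) + card (Range Q)) \<le> card Q"
        unfolding nverts_def by (metis of_nat_le_iff of_nat_mult)
      moreover have "Q \<noteq> {}" using cQ n k by (auto simp: mult_le_0_iff)
      ultimately have "dense_bip k Q" using finite_subset[OF QS finS] by (simp add: dense_bip_def)
      then show ?thesis using Q(2) QS S(1) by blast
    qed
  qed
qed

section \<open>Path systems and sketches\<close>

lemma (in pair_wf_digraph) awalk_length_iff_relpow:
  "(\<exists>p. awalk u p v \<and> length p = n) \<longleftrightarrow> u \<in> pverts G \<and> (u, v) \<in> parcs G ^^ n"
proof (induction n arbitrary: u)
  case 0
  show ?case by (auto simp: awalk_Nil_iff)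
next
  case (Suc n)
  have "(\<exists>p. awalk u p v \<and> length p = Suc n) \<longleftrightarrow> (\<exists>w p. (u, w) \<in> parcs G \<and> awalk w p v \<and> length p = n)"
  proof
    assume "\<exists>p. awalk u p v \<and> length p = Suc n"
    then obtain e p where "awalk u (e # p) v" "length p = n" by (auto simp: length_Suc_conv)
    then show "\<exists>w p. (u, w) \<in> parcs G \<and> awalk w p v \<and> length p = n"
      by (cases e) (auto simp: awalk_Cons_iff)
  next
    assume "\<exists>w p. (u, w) \<in> parcs G \<and> awalk w p v \<and> length p = n"
    then obtain w p where "(u, w) \<in> parcs G" "awalk w p v" "length p = n" by blast
    then show "\<exists>p. awalk u p v \<and> length p = Suc n"
      by (intro exI[of _ "(u, w) # p"]) (simp add: awalk_Cons_iff)
  qed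
  also have "\<dots> \<longleftrightarrow> (\<exists>w. (u, w) \<in> parcs G \<and> (w, v) \<in> parcs G ^^ n)"
    using Suc.IH in_arcsD2 by blast
  also have "\<dots> \<longleftrightarrow> u \<in> pverts G \<and> (u, v) \<in> parcs G ^^ Suc n"
    by (metis in_arcsD1 relpow_Suc_D2 relpow_Suc_I2)
  finally show ?case .
qed

lemma graph_dist_le_iff:
  assumes "pair_wf_digraph G" "u \<in> pverts G"
  shows "graph_dist G u v \<le> ereal (real n) \<longleftrightarrow> (\<exists>m\<le>n. (u, v) \<in> parcs G ^^ m)"
proof -
  interpret pair_wf_digraph G by fact
  have cost: "awalk_cost (\<lambda>_. 1) p = real (length p)" for p :: "('a \<times> 'a) list"
    by (induction p) auto
  have "(\<exists>m\<le>n. (u, v) \<in> parcs G ^^ m) \<longleftrightarrow> (\<exists>p. awalk u p v \<and> length p \<le> n)"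
    using awalk_length_iff_relpow assms(2) by metis
  also have "\<dots> \<longleftrightarrow> \<mu> (\<lambda>_. 1) u v \<le> ereal (real n)"
  proof
    assume "\<exists>p. awalk u p v \<and> length p \<le> n"
    then obtain p where p: "awalk u p v" "length p \<le> n" by blast
    have "\<mu> (\<lambda>_. 1) u v \<le> ereal (awalk_cost (\<lambda>_. 1) p)" using p(1) by (rule min_cost_le_walk_cost)
    also have "\<dots> \<le> ereal (real n)" using p(2) by (simp add: cost)
    finally show "\<mu> (\<lambda>_. 1) u v \<le> ereal (real n)" .
  next
    assume "\<mu> (\<lambda>_. 1) u v \<le> ereal (real n)"
    \<comment> \<open>The strict bound yields an actual walk below the infimum's bound; lengths
      being integers, it has length at most \<open>n\<close>.\<close>
    also have "\<dots> < ereal (real (Suc n))" by simp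
    finally have "\<exists>p. awalk u p v \<and> ereal (awalk_cost (\<lambda>_. 1) p) < ereal (real (Suc n))"
      by (simp add: \<mu>_def INF_less_iff)
    then show "\<exists>p. awalk u p v \<and> length p \<le> n" by (auto simp: cost)
  qed
  finally show ?thesis by (simp add: graph_dist_def)
qed

text \<open>Internally disjoint paths of length \<open>l\<close> in \<open>G\<close>, one for each edge of \<open>R\<close>. Demanding that position \<open>t\<close> on
  one path never equals a different position on another makes all disjointness statements uniform.\<close>
definition path_system :: "'a pair_pre_digraph \<Rightarrow> nat \<Rightarrow> ('a \<times> 'a) set \<Rightarrow> (nat \<Rightarrow> 'a \<times> 'a \<Rightarrow> 'a) \<Rightarrow> bool" where
  "path_system G l R p \<longleftrightarrow> l > 0 \<and>
     (\<forall>e\<in>R. p 0 e = fst e \<and> p l e = snd e \<and> (\<forall>t<l. (p t e, p (Suc t) e) \<in> parcs G)) \<and>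
     (\<forall>e\<in>R. \<forall>e'\<in>R. \<forall>t\<le>l. \<forall>t'\<le>l. p t e = p t' e' \<longrightarrow> t = t' \<and> (e = e' \<or> t = 0 \<or> t = l))"

lemma path_systemD:
  assumes "path_system G l R p"
  shows "l > 0" "e \<in> R \<Longrightarrow> p 0 e = fst e" "e \<in> R \<Longrightarrow> p l e = snd e"
    "e \<in> R \<Longrightarrow> t < l \<Longrightarrow> (p t e, p (Suc t) e) \<in> parcs G"
    "e \<in> R \<Longrightarrow> e' \<in> R \<Longrightarrow> t \<le> l \<Longrightarrow> t' \<le> l \<Longrightarrow> p t e = p t' e' \<Longrightarrow> t = t'"
    "e \<in> R \<Longrightarrow> e' \<in> R \<Longrightarrow> t \<le> l \<Longrightarrow> t' \<le> l \<Longrightarrow> p t e = p t' e' \<Longrightarrow> e = e' \<or> t = 0 \<or> t = l"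
  using assms unfolding path_system_def by blast+

lemma path_system_subset: "path_system G l R p \<Longrightarrow> S \<subseteq> R \<Longrightarrow> path_system G l S p"
  unfolding path_system_def by blast

lemma path_system_converse:
  assumes "path_system G l R p" "sym (parcs G)"
  shows "path_system G l (R\<inverse>) (\<lambda>t e. p (l - t) (prod.swap e))"
  unfolding path_system_def
proof (intro conjI ballI allI impI)
  show "l > 0" using path_systemD(1)[OF assms(1)] .
  fix e assume "e \<in> R\<inverse>"
  then have e: "prod.swap e \<in> R" by (cases e) auto
  show "p (l - 0) (prod.swap e) = fst e" "p (l - l) (prod.swap e) = snd e"
    using path_systemD(2,3)[OF assms(1) e] by simp_all
  show "(p (l - t) (prod.swap e), p (l - Suc t) (prod.swap e)) \<in> parcs G" if "t < l" for t
    using symD[OF assms(2) path_systemD(4)[OF assms(1) e, of "l - Suc t"]] that by (simp add: Suc_diff_Suc)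
  fix e' t t' assume "e' \<in> R\<inverse>" and t: "t \<le> l" "t' \<le> l"
    and eq: "p (l - t) (prod.swap e) = p (l - t') (prod.swap e')"
  then have e': "prod.swap e' \<in> R" by (cases e') auto
  show "t = t'" using path_systemD(5)[OF assms(1) e e' _ _ eq] t by simp
  show "e = e' \<or> t = 0 \<or> t = l" using path_systemD(6)[OF assms(1) e e' _ _ eq] t
    by (metis diff_diff_cancel diff_is_0_eq diff_le_self diff_zero swap_swap)
qed

text \<open>The path of \<open>e\<close> runs backwards from \<open>fst e\<close> to \<alpha> e and
  then forwards to \<open>snd e\<close>. Injectivity of \<alpha> keeps the midpoints distinct, and
  the disjoint sides of \<open>Q\<close> keep first halves away from second halves.\<close>

lemma path_system_one_subdivision:
  assumes p: "path_system G l R p" and sym: "sym (parcs G)" and Q: "one_subdivision Q R"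
  shows "\<exists>q. path_system G (2 * l) Q q"
proof -
  obtain \<alpha> where \<alpha>: "inj_on \<alpha> Q" "\<And>i j. (i, j) \<in> Q \<Longrightarrow> (\<alpha> (i, j), i) \<in> R \<and> (\<alpha> (i, j), j) \<in> R"
    and disj: "Domain Q \<inter> Range Q = {}"
    using Q unfolding one_subdivision_def by blast
  have \<alpha>1: "(\<alpha> e, fst e) \<in> R" and \<alpha>2: "(\<alpha> e, snd e) \<in> R" if "e \<in> Q" for e
    using \<alpha>(2)[of "fst e" "snd e"] that by auto
  define q where "q t e = (if t \<le> l then p (l - t) (\<alpha> e, fst e) else p (t - l) (\<alpha> e, snd e))" for t and e :: "'a \<times> 'a"
  note P = path_systemD[OF p]
  have ne: "fst e \<noteq> snd e'" if "e \<in> Q" "e' \<in> Q" for e e'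
    using that disj by (metis Domain.DomainI IntI Range.RangeI empty_iff prod.collapse)
  \<comment> \<open>A common point has the same positive level on two paths for \<open>R\<close>.
    Either their edges coincide or the point is their common right end; both give
    \<open>fst e = snd e'\<close>.\<close>
  have mixed: False if "e \<in> Q" "e' \<in> Q" "t \<le> l" "l < t'" "t' \<le> 2 * l" "q t e = q t' e'" for e e' t t'
  proof -
    have eq: "p (l - t) (\<alpha> e, fst e) = p (t' - l) (\<alpha> e', snd e')" using that by (simp add: q_def)
    have t: "l - t = t' - l" using P(5)[OF \<alpha>1 \<alpha>2 _ _ eq] that by simp
    have "(\<alpha> e, fst e) = (\<alpha> e', snd e') \<or> l - t = 0 \<or> l - t = l"
      using P(6)[OF \<alpha>1 \<alpha>2 _ _ eq] that by simp
    then show False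
      using ne[OF that(1,2)] t that eq P(3)[OF \<alpha>1[OF that(1)]] P(3)[OF \<alpha>2[OF that(2)]] by auto
  qed
  have "path_system G (2 * l) Q q"
    unfolding path_system_def
  proof (intro conjI ballI allI impI)
    show "2 * l > 0" using P(1) by simp
    fix e assume e: "e \<in> Q"
    show "q 0 e = fst e" "q (2 * l) e = snd e"
      using P(1) P(3)[OF \<alpha>1[OF e]] P(3)[OF \<alpha>2[OF e]] by (simp_all add: q_def)
    show "(q t e, q (Suc t) e) \<in> parcs G" if "t < 2 * l" for t
    proof -
      consider "t < l" | "t = l" | "t > l" by linarith
      then show ?thesis
      proof cases
        case 1
        then show ?thesis
          using symD[OF sym P(4)[OF \<alpha>1[OF e], of "l - Suc t"]] by (simp add: q_def Suc_diff_Suc)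
      next
        case 2
        then show ?thesis
          using P(4)[OF \<alpha>2[OF e], of 0] P(1) P(2)[OF \<alpha>1[OF e]] P(2)[OF \<alpha>2[OF e]] by (simp add: q_def)
      next
        case 3
        then show ?thesis
          using P(4)[OF \<alpha>2[OF e], of "t - l"] that by (simp add: q_def Suc_diff_le)
      qed
    qed
    fix e' t t' assume e': "e' \<in> Q" and t: "t \<le> 2 * l" "t' \<le> 2 * l" and eq: "q t e = q t' e'"
    have "t = t' \<and> (e = e' \<or> t = 0 \<or> t = 2 * l)"
    proof (cases "t \<le> l"; cases "t' \<le> l")
      assume le: "t \<le> l" "t' \<le> l"
      have eq': "p (l - t) (\<alpha> e, fst e) = p (l - t') (\<alpha> e', fst e')" using le eq by (simp add: q_def)
      have tt: "t = t'" using P(5)[OF \<alpha>1[OF e] \<alpha>1[OF e'] _ _ eq'] le by simp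
      have "(\<alpha> e, fst e) = (\<alpha> e', fst e') \<or> l - t = 0 \<or> l - t = l"
        using P(6)[OF \<alpha>1[OF e] \<alpha>1[OF e'] _ _ eq'] le by simp
      moreover have "\<alpha> e = \<alpha> e'" if "l - t = 0"
        using that eq' tt P(2)[OF \<alpha>1[OF e]] P(2)[OF \<alpha>1[OF e']] by simp
      ultimately show ?thesis using tt inj_onD[OF \<alpha>(1) _ e e'] P(1) le by auto
    next
      assume "t \<le> l" "\<not> t' \<le> l"
      then show ?thesis using mixed[OF e e' _ _ _ eq] t by auto
    next
      assume "\<not> t \<le> l" "t' \<le> l"
      then show ?thesis using mixed[OF e' e _ _ _ eq[symmetric]] t by auto
    next
      assume le: "\<not> t \<le> l" "\<not> t' \<le> l"
      have eq': "p (t - l) (\<alpha> e, snd e) = p (t' - l) (\<alpha> e', snd e')" using le eq by (simp add: q_def)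
      have tt: "t - l = t' - l" using P(5)[OF \<alpha>2[OF e] \<alpha>2[OF e'] _ _ eq'] le t by simp
      have "(\<alpha> e, snd e) = (\<alpha> e', snd e') \<or> t - l = 0 \<or> t - l = l"
        using P(6)[OF \<alpha>2[OF e] \<alpha>2[OF e'] _ _ eq'] le t by simp
      then show ?thesis using tt inj_onD[OF \<alpha>(1) _ e e'] le t by auto
    qed
    then show "t = t'" "e = e' \<or> t = 0 \<or> t = 2 * l" by auto
  qed
  then show ?thesis by blast
qed

text \<open>All vertices of \<open>G\<close> are kept, so the sketches for different
  \<open>S\<close> are functions on one fixed set.\<close>

definition path_graph :: "'a pair_pre_digraph \<Rightarrow> nat \<Rightarrow> (nat \<Rightarrow> 'a \<times> 'a \<Rightarrow> 'a) \<Rightarrow> ('a \<times> 'a) set \<Rightarrow> 'a pair_pre_digraph" where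
  "path_graph G l p S = \<lparr> pverts = pverts G,
     parcs = {(x, y). \<exists>e\<in>S. \<exists>t<l. (x, y) = (p t e, p (Suc t) e) \<or> (y, x) = (p t e, p (Suc t) e)} \<rparr>"

lemma graph_subgraph_path_graph:
  assumes "pair_graph G" "path_system G l R p" "S \<subseteq> R"
  shows "graph_subgraph (path_graph G l p S) G"
proof -
  interpret pair_graph G by fact
  have sub: "parcs (path_graph G l p S) \<subseteq> parcs G"
    using path_systemD(4)[OF assms(2)] assms(3) arcs_symmetric
    by (auto simp: path_graph_def)
  have "sym (parcs (path_graph G l p S))" by (auto simp: path_graph_def intro: symI)
  moreover have "pverts (path_graph G l p S) = pverts G" by (simp add: path_graph_def)
  ultimately have "pair_graph (path_graph G l p S)"
    using sub finite_subset[OF sub pair_finite_arcs] pair_finite_verts pair_no_loops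
    by unfold_locales (auto simp: symmetric_def dest!: subsetD[OF sub] intro: in_arcsD1 in_arcsD2)
  then interpret H: pair_graph "path_graph G l p S" .
  show ?thesis
    using sub wf_digraph_axioms H.wf_digraph_axioms H.pair_graph unfolding graph_subgraph_def subgraph_def
    by (auto simp: path_graph_def compatible_def)
qed

lemma path_graph_near:
  assumes "path_system G l R p" "S \<subseteq> R" "e \<in> S"
  shows "(fst e, snd e) \<in> parcs (path_graph G l p S) ^^ l"
proof -
  have "(p 0 e, p t e) \<in> parcs (path_graph G l p S) ^^ t" if "t \<le> l" for t
    using that
  proof (induction t)
    case (Suc t)
    then have "(p t e, p (Suc t) e) \<in> parcs (path_graph G l p S)"
      using assms(3) by (force simp: path_graph_def)
    then show ?case using Suc by (auto intro: relpow_Suc_I)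
  qed simp
  from this[of l] show ?thesis
    using path_systemD(2,3)[OF assms(1)] assms(2,3) by (metis order_refl subsetD)
qed

text \<open>In the bipartite \<open>C\<^sub>4\<close>-free graph \<open>R\<close> the ends of an edge missing from \<open>S\<close> are at distance at least 5
  in \<open>S\<close>. The levels 0, ..., 5 of the vertices of \<open>R\<close> are interpolated along the paths to a function
  that changes by at most one along each edge.\<close>
lemma path_graph_far:
  assumes p: "path_system G l R p" and C4: "C4_free R" and S: "S \<subseteq> R" and e0: "e0 \<in> R" "e0 \<notin> S"
    and walk: "(fst e0, snd e0) \<in> parcs (path_graph G l p S) ^^ m"
  shows "5 * l \<le> m"
proof -
  note P = path_systemD[OF p]
  obtain u v where uv: "e0 = (u, v)" by (cases e0)
  \<comment> \<open>Distances from \<open>u\<close> in \<open>S\<close>, capped at 4 on the left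
    side and at 5 on the right side.\<close>
  define hA :: "'a \<Rightarrow> nat" where "hA a = (if a = u then 0 else if \<exists>b. (u, b) \<in> S \<and> (a, b) \<in> S then 2 else 4)" for a
  define hB :: "'a \<Rightarrow> nat" where "hB b = (if (u, b) \<in> S then 1
      else if \<exists>a b'. (u, b') \<in> S \<and> (a, b') \<in> S \<and> (a, b) \<in> S then 3 else 5)" for b
  \<comment> \<open>Level 3 would mean a path u, b', a, v in \<open>S\<close>, which together with
    the edge \<open>e0\<close> of \<open>R\<close> is a 4-cycle unless it degenerates to
    \<open>e0\<close> itself.\<close>
  have hv: "hB v = 5"
  proof -
    have "\<not> ((u, b') \<in> S \<and> (a, b') \<in> S \<and> (a, v) \<in> S)" for a b'
      using C4_freeD[OF C4, of u v b' a] S e0 uv by blast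
    then show ?thesis using e0 uv by (simp add: hB_def)
  qed
  have h: "hA (fst e) \<le> hB (snd e) + 1" "hB (snd e) \<le> hA (fst e) + 1" if "e \<in> S" for e
    using that by (cases e; auto simp: hA_def hB_def)+
  \<comment> \<open>The level of an inner vertex is reached through the cheaper of the two ends of
    its path.\<close>
  define \<psi> where "\<psi> t e = min (l * hA (fst e) + t) (l * hB (snd e) + (l - t))" for t e
  have \<psi>0: "\<psi> 0 e = l * hA (fst e)" and \<psi>l: "\<psi> l e = l * hB (snd e)" if "e \<in> S" for e
    using mult_le_mono2[OF h(1)[OF that], of l] mult_le_mono2[OF h(2)[OF that], of l]
    by (simp_all add: \<psi>_def add.commute)
  \<comment> \<open>Different paths meet only in ends of equal position, so \<psi> depends on the
    vertex alone.\<close>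
  have \<psi>_eq: "\<psi> t e = \<psi> t' e'" if "e \<in> S" "e' \<in> S" "t \<le> l" "t' \<le> l" "p t e = p t' e'" for t t' e e'
  proof -
    have eR: "e \<in> R" "e' \<in> R" using that S by auto
    have tt: "t = t'" using P(5)[OF eR that(3,4,5)] .
    have "e = e' \<or> t = 0 \<or> t = l" using P(6)[OF eR that(3,4,5)] .
    then show ?thesis
    proof (elim disjE)
      assume "t = 0"
      then show ?thesis using that(5) tt P(2) eR \<psi>0 that(1,2) by simp
    next
      assume "t = l"
      then show ?thesis using that(5) tt P(3) eR \<psi>l that(1,2) by simp
    qed (simp add: tt)
  qed
  have step: "\<psi> (Suc t) e \<le> \<psi> t e + 1" "\<psi> t e \<le> \<psi> (Suc t) e + 1" if "t < l" for t e
    using that by (auto simp: \<psi>_def)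
  have inv: "\<psi> t e \<le> m" if "(u, w) \<in> parcs (path_graph G l p S) ^^ m" "e \<in> S" "t \<le> l" "p t e = w" for m w t e
    using that
  proof (induction m arbitrary: w t e)
    case 0
    have eR: "e \<in> R" using 0 S by auto
    have "p t e = p 0 e0" using 0 P(2)[OF e0(1)] uv by simp
    then have "t = 0" using P(5)[OF eR e0(1) 0(3)] by simp
    moreover from this have "fst e = u" using 0 P(2)[OF eR] by simp
    ultimately show ?case using \<psi>0[OF 0(2)] by (simp add: hA_def)
  next
    case (Suc m)
    then obtain z where z: "(u, z) \<in> parcs (path_graph G l p S) ^^ m" "(z, w) \<in> parcs (path_graph G l p S)" by (auto elim: relpow_Suc_E)
    from z(2) obtain t' e' where e': "e' \<in> S" "t' < l" and
      or: "z = p t' e' \<and> w = p (Suc t') e' \<or> w = p t' e' \<and> z = p (Suc t') e'"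
      by (auto simp: path_graph_def)
    from or show ?case
    proof
      assume zw: "z = p t' e' \<and> w = p (Suc t') e'"
      then have "\<psi> t' e' \<le> m" using Suc.IH[OF z(1) e'(1), of t'] e'(2) by auto
      moreover have "\<psi> t e = \<psi> (Suc t') e'" using Suc.prems e' zw by (intro \<psi>_eq) auto
      ultimately show ?thesis using step(1)[OF e'(2), of e'] by linarith
    next
      assume zw: "w = p t' e' \<and> z = p (Suc t') e'"
      then have "\<psi> (Suc t') e' \<le> m" using Suc.IH[OF z(1) e'(1), of "Suc t'"] e'(2) by auto
      moreover have "\<psi> t e = \<psi> t' e'" using Suc.prems e' zw by (intro \<psi>_eq) auto
      ultimately show ?thesis using step(2)[OF e'(2), of e'] by linarith
    qed
  qed
  \<comment> \<open>A nonempty walk ending in \<open>v\<close> puts \<open>v\<close> on a kept path,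
    necessarily as its right end, where \<psi> equals \<open>5 * l\<close>. If no kept path contains
    \<open>v\<close>, there is no walk at all.\<close>
  have "p 0 e0 \<noteq> p l e0" using P(5)[OF e0(1) e0(1), of 0 l] P(1) by auto
  then have "u \<noteq> v" using P(2,3)[OF e0(1)] uv by simp
  then obtain m' z where "m = Suc m'" "(z, v) \<in> parcs (path_graph G l p S)"
    using walk uv by (cases m) auto
  then obtain t e where e: "e \<in> S" "t \<le> l" "p t e = v"
    by (auto simp: path_graph_def) (metis Suc_leI less_imp_le)+
  have eR: "e \<in> R" using e S by auto
  have "p t e = p l e0" using e P(3)[OF e0(1)] uv by simp
  then have "t = l" using P(5)[OF eR e0(1) e(2)] by simp
  then have "snd e = v" using P(3)[OF eR] e(3) by simp
  then have "\<psi> t e = 5 * l" using \<psi>l[OF e(1)] \<open>t = l\<close> hv by simp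
  then show ?thesis using inv[OF _ e] walk uv by simp
qed

section \<open>Recovering a set of edges from a sketch and its errors\<close>

lemma exists_few_errors:
  fixes P :: "'b pmf" and err :: "'b \<Rightarrow> 'e \<Rightarrow> bool"
  assumes fin: "finite R" and le: "\<And>e. e \<in> R \<Longrightarrow> measure_pmf.prob P {x. err x e} \<le> 1/3"
  shows "\<exists>x\<in>set_pmf P. 3 * card {e \<in> R. err x e} \<le> card R"
proof (rule ccontr)
  assume "\<not> ?thesis"
  \<comment> \<open>Integrality turns the strict inequality into a uniform gap, which survives
    taking the expectation.\<close>
  then have gt: "(card R + 1) / 3 \<le> card {e \<in> R. err x e}" if "x \<in> set_pmf P" for x
    using that by (auto simp: not_le Suc_le_eq)
  have card: "real (card {e \<in> R. err x e}) = (\<Sum>e\<in>R. indicator {x. err x e} x)" for x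
    using fin by (simp add: indicator_def sum.If_cases Int_def)
  have int: "integrable (measure_pmf P) (indicator {x. err x e} :: _ \<Rightarrow> real)" for e
    by (rule measure_pmf.integrable_const_bound[where B = 1]) (auto simp: indicator_def)
  have "(card R + 1) / 3 \<le> measure_pmf.expectation P (\<lambda>x. real (card {e \<in> R. err x e}))"
    using gt by (intro measure_pmf.integral_ge_const) (auto simp: card AE_measure_pmf_iff intro!: Bochner_Integration.integrable_sum int)
  also have "\<dots> = (\<Sum>e\<in>R. measure_pmf.prob P {x. err x e})"
    unfolding card by (subst Bochner_Integration.integral_sum) (auto intro: int)
  also have "\<dots> \<le> (\<Sum>e\<in>R. 1/3)" using le by (rule sum_mono)
  also have "\<dots> = card R / 3" by simp
  finally show False by simp
qed

text \<open>Giving \<open>W\<close> the weight 2^(m - |W|) makes the total weight of all subsets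
  3^m, and each small \<open>W\<close> weighs at least 2^(2m/3). Cubing avoids thirds in the
  exponents.\<close>

lemma card_small_subsets:
  assumes "finite R"
  shows "card {W. W \<subseteq> R \<and> 3 * card W \<le> card R} ^ 3 * 4 ^ card R \<le> (27 :: nat) ^ card R"
proof -
  let ?F = "{W. W \<subseteq> R \<and> 3 * card W \<le> card R}"
  let ?m = "card R"
  let ?k = "?m - ?m div 3"
  have "card ?F * 2 ^ ?k = (\<Sum>W\<in>?F. 2 ^ ?k)" by simp
  also have "\<dots> \<le> (\<Sum>W\<in>?F. 2 ^ (?m - card W))"
    by (intro sum_mono power_increasing) auto
  also have "\<dots> \<le> (\<Sum>W\<in>Pow R. 2 ^ (?m - card W))"
    using assms by (intro sum_mono2) auto
  also have "\<dots> = (\<Sum>W\<in>Pow R. (\<Prod>e\<in>W. 1) * (\<Prod>e\<in>R - W. 2))"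
  proof (rule sum.cong)
    fix W assume "W \<in> Pow R"
    then show "2 ^ (?m - card W) = (\<Prod>e\<in>W. 1) * (\<Prod>e\<in>R - W. 2)"
      using assms by (simp add: card_Diff_subset finite_subset)
  qed simp
  also have "\<dots> = (\<Prod>e\<in>R. 1 + 2)" using assms by (rule prod_add[symmetric])
  also have "\<dots> = (1 + 2) ^ ?m" by (rule prod_constant)
  also have "1 + 2 = (3 :: nat)" by simp
  finally have le: "card ?F * 2 ^ ?k \<le> 3 ^ ?m" .
  have "card ?F ^ 3 * 4 ^ ?m = card ?F ^ 3 * 2 ^ (2 * ?m)" by (simp add: power_mult)
  also have "\<dots> \<le> card ?F ^ 3 * 2 ^ (?k * 3)" by (intro mult_le_mono2 power_increasing) auto
  also have "\<dots> = (card ?F * 2 ^ ?k) ^ 3" by (simp add: power_mult_distrib power_mult)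
  also have "\<dots> \<le> (3 ^ ?m) ^ 3" using le by (rule power_mono) simp
  also have "\<dots> = 27 ^ ?m" using power_mult[of "3 :: nat" 3 ?m] by (simp flip: power_mult add: mult.commute)
  finally show ?thesis .
qed

text \<open>Each \<open>S\<close> is the symmetric difference of the set predicted by some sketch
  value and a small error set. Hence 2^m is at most 2^(s n) times the number of small sets, and
  cubing gives 32^m \<le> 8^(s n) 27^m.\<close>

lemma sketch_counting:
  fixes R :: "('a \<times> 'a) set" and D :: "bool list \<Rightarrow> bool list \<Rightarrow> bool"
  assumes fin: "finite R" and X: "Domain R \<union> Range R \<subseteq> X"
    and sk: "\<And>S. S \<subseteq> R \<Longrightarrow> \<exists>P :: ('a \<Rightarrow> bool list) pmf. set_pmf P \<subseteq> (X \<rightarrow>\<^sub>E {w. length w = s}) \<and>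
      (\<forall>e\<in>S. measure_pmf.prob P {sk. D (sk (fst e)) (sk (snd e))} \<ge> 2/3) \<and>
      (\<forall>e\<in>R - S. measure_pmf.prob P {sk. \<not> D (sk (fst e)) (sk (snd e))} \<ge> 2/3)"
  shows "card R \<le> 13 * s * (card (Domain R) + card (Range R))"
proof -
  define V where "V = Domain R \<union> Range R"
  define m where "m = card R"
  define n where "n = card V"
  have finV: "finite V" using fin by (simp add: V_def finite_Domain finite_Range)
  have n: "n \<le> card (Domain R) + card (Range R)" unfolding n_def V_def by (rule card_Un_le)
  define pred where "pred \<tau> = {e \<in> R. D (\<tau> (fst e)) (\<tau> (snd e))}" for \<tau>
  let ?words = "{w :: bool list. length w = s}"
  let ?F = "{W. W \<subseteq> R \<and> 3 * card W \<le> card R}"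
  have words: "finite ?words" "card ?words = 2 ^ s"
    using card_lists_length_eq[of "UNIV :: bool set" s] finite_lists_length_eq[of "UNIV :: bool set" s] by simp_all
  have "Pow R \<subseteq> (\<lambda>(\<tau>, W). sym_diff (pred \<tau>) W) ` ((V \<rightarrow>\<^sub>E ?words) \<times> ?F)"
  proof
    fix S assume "S \<in> Pow R"
    then have S: "S \<subseteq> R" by simp
    from sk[OF S] obtain P :: "('a \<Rightarrow> bool list) pmf" where P: "set_pmf P \<subseteq> (X \<rightarrow>\<^sub>E ?words)"
      "\<And>e. e \<in> S \<Longrightarrow> measure_pmf.prob P {sk. D (sk (fst e)) (sk (snd e))} \<ge> 2/3"
      "\<And>e. e \<in> R - S \<Longrightarrow> measure_pmf.prob P {sk. \<not> D (sk (fst e)) (sk (snd e))} \<ge> 2/3"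
      by blast
    have compl: "measure_pmf.prob P {sk. \<not> A sk} = 1 - measure_pmf.prob P {sk. A sk}" for A
      using measure_pmf.prob_compl[of "{sk. A sk}" P] by (simp add: Compl_eq_Diff_UNIV[symmetric] Collect_neg_eq)
    have "measure_pmf.prob P {sk. D (sk (fst e)) (sk (snd e)) \<noteq> (e \<in> S)} \<le> 1/3" if "e \<in> R" for e
      using P(2,3)[of e] that compl[of "\<lambda>sk. D (sk (fst e)) (sk (snd e))"] by (cases "e \<in> S") auto
    then obtain \<tau> where \<tau>: "\<tau> \<in> set_pmf P" "3 * card {e \<in> R. D (\<tau> (fst e)) (\<tau> (snd e)) \<noteq> (e \<in> S)} \<le> card R"
      using exists_few_errors[OF fin, of P "\<lambda>sk e. D (sk (fst e)) (sk (snd e)) \<noteq> (e \<in> S)"] by blast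
    \<comment> \<open>Only the values on the ends matter for the prediction; counting functions on
      all of \<open>X\<close> would bring in the inner path vertices.\<close>
    have "restrict \<tau> V \<in> V \<rightarrow>\<^sub>E ?words" using \<tau>(1) P(1) X unfolding restrict_PiE_iff V_def by blast
    moreover have "pred (restrict \<tau> V) = pred \<tau>"
      unfolding pred_def V_def by (intro Collect_cong conj_cong refl) (auto simp: Domain.simps Range.simps)
    moreover have "S = sym_diff (pred \<tau>) {e \<in> R. D (\<tau> (fst e)) (\<tau> (snd e)) \<noteq> (e \<in> S)}"
      using S by (auto simp: pred_def)
    ultimately show "S \<in> (\<lambda>(\<tau>, W). sym_diff (pred \<tau>) W) ` ((V \<rightarrow>\<^sub>E ?words) \<times> ?F)"
      using \<tau>(2) by (intro image_eqI[of _ _ "(restrict \<tau> V, {e \<in> R. D (\<tau> (fst e)) (\<tau> (snd e)) \<noteq> (e \<in> S)})"]) auto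
  qed
  then have "card (Pow R) \<le> card ((V \<rightarrow>\<^sub>E ?words) \<times> ?F)"
    using finV words(1) fin by (intro surj_card_le finite_cartesian_product finite_PiE) auto
  then have "2 ^ m \<le> (2 ^ s) ^ n * card ?F"
    using fin finV by (simp add: card_Pow card_cartesian_product card_PiE words m_def n_def)
  then have "(2 ^ m) ^ 3 \<le> ((2 ^ s) ^ n * card ?F) ^ 3" by (rule power_mono) simp
  also have "\<dots> = 8 ^ (s * n) * card ?F ^ 3"
    by (simp add: power_mult_distrib flip: power_mult) (simp add: mult.commute[of _ 3] power_mult)
  finally have "8 ^ m \<le> 8 ^ (s * n) * card ?F ^ 3"
    by (simp add: mult.commute[of _ 3] flip: power_mult) (simp add: power_mult)
  then have "8 ^ m * 4 ^ m \<le> (8 ^ (s * n) * card ?F ^ 3) * 4 ^ m" by (rule mult_le_mono1)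
  also have "\<dots> \<le> 8 ^ (s * n) * 27 ^ m"
    using card_small_subsets[OF fin] by (simp add: m_def mult.assoc)
  finally have main: "(32 :: nat) ^ m \<le> 8 ^ (s * n) * 27 ^ m" by (simp flip: power_mult_distrib)
  have "m \<le> 13 * (s * n)"
  proof (rule ccontr)
    assume "\<not> m \<le> 13 * (s * n)"
    then obtain j where j: "m = 13 * (s * n) + Suc j" by (metis add_Suc_right less_imp_Suc_add not_le)
    \<comment> \<open>13 is the least exponent at which the powers of 32/27 reach 8.\<close>
    have "8 * 27 ^ 13 \<le> (32 :: nat) ^ 13" by simp
    then have "(8 * 27 ^ 13) ^ (s * n) \<le> ((32 :: nat) ^ 13) ^ (s * n)" by (rule power_mono) simp
    moreover have "(27 :: nat) ^ Suc j < 32 ^ Suc j" by (rule power_strict_mono) auto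
    ultimately have "(8 * 27 ^ 13) ^ (s * n) * 27 ^ Suc j < ((32 :: nat) ^ 13) ^ (s * n) * 32 ^ Suc j"
      by (intro mult_le_less_imp_less) auto
    then have "8 ^ (s * n) * 27 ^ m < (32 :: nat) ^ m"
      unfolding j power_add power_mult[of _ 13] power_mult_distrib[of 8] by (simp only: mult.assoc)
    then show False using main by simp
  qed
  also have "\<dots> \<le> 13 * (s * (card (Domain R) + card (Range R)))" using n by simp
  finally show ?thesis by (simp add: m_def mult.assoc)
qed

theorem sketch_bounds_path_system:
  assumes \<F>: "monotone_class \<F>" "has_distance_sketch \<F> l (5 * l - 1) s"
    and G: "G \<in> \<F>" "pair_graph G" and p: "path_system G l R p" and C4: "C4_free R" and fin: "finite R"
  shows "card R \<le> 13 * s * (card (Domain R) + card (Range R))"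
proof -
  \<comment> \<open>The decoder is chosen before \<open>S\<close>, so a sketch value alone
    determines the predicted edges.\<close>
  obtain D where D: "distance_sketch D l (5 * l - 1) s \<F>"
    using \<F>(2) unfolding has_distance_sketch_def by blast
  interpret G: pair_graph G by fact
  note P = path_systemD[OF p]
  have ends: "fst e \<in> pverts G" "snd e \<in> pverts G" if "e \<in> R" for e
  proof -
    show "fst e \<in> pverts G" using P(4)[OF that, of 0] P(1) P(2)[OF that] G.in_arcsD1 by metis
    show "snd e \<in> pverts G" using P(4)[OF that, of "l - 1"] P(1) P(3)[OF that] G.in_arcsD2
      by (metis Suc_diff_1 diff_less less_one)
  qed
  show ?thesis
  proof (rule sketch_counting[OF fin])
    show "Domain R \<union> Range R \<subseteq> pverts G" using ends by force
    fix S assume S: "S \<subseteq> R"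
    let ?H = "path_graph G l p S"
    have H: "graph_subgraph ?H G" using graph_subgraph_path_graph[OF G(2) p S] .
    then have "?H \<in> \<F>" using \<F>(1) G(1) unfolding monotone_class_def by blast
    from bspec[OF D[unfolded distance_sketch_def] this] obtain P :: "('a \<Rightarrow> bool list) pmf"
      where P: "set_pmf P \<subseteq> (pverts ?H \<rightarrow>\<^sub>E {w. length w = s})"
        and acc: "\<forall>x\<in>pverts ?H. \<forall>y\<in>pverts ?H.
           (graph_dist ?H x y \<le> ereal (real l) \<longrightarrow> measure_pmf.prob P {sk. D (sk x) (sk y)} \<ge> 2/3) \<and>
           (graph_dist ?H x y > ereal (real (5 * l - 1)) \<longrightarrow> measure_pmf.prob P {sk. \<not> D (sk x) (sk y)} \<ge> 2/3)"
      by (elim exE conjE)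
    have V: "pverts ?H = pverts G" by (simp add: path_graph_def)
    interpret H: pair_graph ?H using H by (simp add: graph_subgraph_def)
    note wf = H.pair_wf_digraph
    have near: "measure_pmf.prob P {sk. D (sk (fst e)) (sk (snd e))} \<ge> 2/3" if "e \<in> S" for e
    proof -
      have e: "fst e \<in> pverts ?H" "snd e \<in> pverts ?H" using ends[of e] that S V by auto
      have "graph_dist ?H (fst e) (snd e) \<le> ereal (real l)"
        unfolding graph_dist_le_iff[OF wf e(1)] using path_graph_near[OF p S that] by blast
      then show ?thesis using bspec[OF bspec[OF acc e(1)] e(2)] by (elim conjE) (rule mp)
    qed
    have far: "measure_pmf.prob P {sk. \<not> D (sk (fst e)) (sk (snd e))} \<ge> 2/3" if "e \<in> R - S" for e
    proof -
      have e: "fst e \<in> pverts ?H" "snd e \<in> pverts ?H" using ends[of e] that V by auto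
      have "\<not> graph_dist ?H (fst e) (snd e) \<le> ereal (real (5 * l - 1))"
      proof
        assume "graph_dist ?H (fst e) (snd e) \<le> ereal (real (5 * l - 1))"
        then obtain m where "m \<le> 5 * l - 1" "(fst e, snd e) \<in> parcs ?H ^^ m"
          unfolding graph_dist_le_iff[OF wf e(1)] by blast
        moreover have "5 * l \<le> m" using path_graph_far[OF p C4 S _ _ calculation(2)] that by blast
        \<comment> \<open>As \<open>l\<close> is positive, the truncated \<open>5 * l - 1\<close>
          lies strictly below \<open>5 * l\<close>.\<close>
        ultimately show False using path_systemD(1)[OF p] by linarith
      qed
      then have "graph_dist ?H (fst e) (snd e) > ereal (real (5 * l - 1))" by simp
      then show ?thesis using bspec[OF bspec[OF acc e(1)] e(2)] by (elim conjE) (rule mp)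
    qed
    show "\<exists>P :: ('a \<Rightarrow> bool list) pmf. set_pmf P \<subseteq> (pverts G \<rightarrow>\<^sub>E {w. length w = s}) \<and>
      (\<forall>e\<in>S. measure_pmf.prob P {sk. D (sk (fst e)) (sk (snd e))} \<ge> 2/3) \<and>
      (\<forall>e\<in>R - S. measure_pmf.prob P {sk. \<not> D (sk (fst e)) (sk (snd e))} \<ge> 2/3)"
      using P near far unfolding V by (intro exI[of _ P] conjI ballI)
  qed
qed

section \<open>Path systems in depth minors\<close>

text \<open>Pairing \<open>f e\<close> with \<open>e\<close> makes the fibres of \<open>f\<close>
  the rows of a relation, to which the row counts apply.\<close>

lemma Image_fibers:
  "Domain ((\<lambda>e. (f e, e)) ` E) = f ` E" "((\<lambda>e. (f e, e)) ` E) `` {y} = {e \<in> E. f e = y}"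
  "card ((\<lambda>e. (f e, e)) ` E) = card E"
  by (force, force) (simp add: card_image inj_on_def)

lemma card_ge_fibers:
  assumes "finite E" "\<And>e. e \<in> E \<Longrightarrow> n \<le> card {e' \<in> E. f e' = f e}"
  shows "card (f ` E) * n \<le> card E"
  using card_ge_Domain_mult[of "(\<lambda>e. (f e, e)) ` E" n] assms unfolding Image_fibers by auto

lemma card_le_fibers:
  assumes "finite E" "\<And>e. e \<in> E \<Longrightarrow> card {e' \<in> E. f e' = f e} \<le> n"
  shows "card E \<le> card (f ` E) * n"
  using card_le_Domain_mult[of "(\<lambda>e. (f e, e)) ` E" "f ` E" n] assms unfolding Image_fibers by auto

lemma large_fiber:
  assumes "finite Z" "finite E" "E \<noteq> {}" "f ` E \<subseteq> Z"
  shows "\<exists>z. card E \<le> card Z * card {e \<in> E. f e = z}"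
proof -
  let ?c = "\<lambda>z. card {e \<in> E. f e = z}"
  have "Max (?c ` Z) \<in> ?c ` Z" using assms by (intro Max_in) auto
  then obtain z where z: "Max (?c ` Z) = ?c z" by (metis (no_types, lifting) imageE)
  have "card E \<le> card (f ` E) * ?c z"
    using assms by (intro card_le_fibers) (auto simp flip: z intro!: Max_ge)
  also have "\<dots> \<le> card Z * ?c z" using assms by (intro mult_le_mono1 card_mono)
  finally show ?thesis by blast
qed

lemma inj_on_later_levels:
  assumes tied: "\<And>t e e'. t < j \<Longrightarrow> e \<in> E \<Longrightarrow> e' \<in> E \<Longrightarrow> p (Suc t) e = p (Suc t) e' \<Longrightarrow> p t e = p t e'"
    and inj: "inj_on (p i) E"
  shows "i \<le> t \<Longrightarrow> t \<le> j \<Longrightarrow> inj_on (p t) E"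
proof (induction t)
  case 0
  then show ?case using inj by simp
next
  case (Suc t)
  show ?case
  proof (cases "i = Suc t")
    case False
    then have IH: "inj_on (p t) E" and tj: "t < j" using Suc by auto
    show ?thesis
    proof (rule inj_onI)
      fix e e' assume e: "e \<in> E" "e' \<in> E" "p (Suc t) e = p (Suc t) e'"
      show "e = e'" by (rule inj_onD[OF IH tied[OF tj e] e(1,2)])
    qed
  qed (use inj in simp)
qed

text \<open>One side of the trees is removed level by level: if most edges leave through vertices of the next
  level that carry many edges, these vertices become the new roots; otherwise one edge is kept
  for each of these vertices, and from there on the tree paths are disjoint.\<close>
lemma peel_levels:
  fixes p :: "nat \<Rightarrow> 'e \<Rightarrow> 'v" and g :: "'e \<Rightarrow> 'w"
  assumes "finite E" "E \<noteq> {}" "d > 0" "i \<le> j"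
    and "\<forall>t<j. \<forall>e\<in>E. \<forall>e'\<in>E. p (Suc t) e = p (Suc t) e' \<longrightarrow> p t e = p t e'"
    and "d * (4 * d) ^ (j - i) * (card (p i ` E) + card (g ` E)) \<le> card E"
  shows "\<exists>i' E'. i' \<le> j \<and> E' \<subseteq> E \<and> E' \<noteq> {} \<and> d * (card (p i' ` E') + card (g ` E')) \<le> card E' \<and>
           (\<forall>t. i' < t \<longrightarrow> t \<le> j \<longrightarrow> inj_on (p t) E')"
  using assms
proof (induction "j - i" arbitrary: i E)
  case 0
  then show ?case by (intro exI[of _ i] exI[of _ E]) auto
next
  case (Suc n)
  let ?f = "p (Suc i)"
  \<comment> \<open>One level costs a factor \<open>4 * d\<close>: \<open>c\<close> is the density
    that the induction hypothesis asks for at level \<open>Suc i\<close>.\<close>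
  define c where "c = d * (4 * d) ^ n"
  have n: "n = j - Suc i" "Suc i \<le> j" using Suc.hyps(2) by auto
  have c: "c > 0" "d * (4 * d) ^ (j - i) = 4 * d * c" using Suc.prems(3) by (simp_all add: c_def flip: Suc.hyps(2))
  have dens: "4 * d * c * (card (p i ` E) + card (g ` E)) \<le> card E" using Suc.prems(6) unfolding c(2) .
  \<comment> \<open>If these edges are at least half of \<open>E\<close>, their next-level vertices
    number at most \<open>card B / (2 * c)\<close> and so do the values of \<open>g\<close>, which
    together gives density \<open>c\<close>.\<close>
  define B where "B = {e \<in> E. 2 * c \<le> card {e' \<in> E. ?f e' = ?f e}}"
  have BE: "B \<subseteq> E" and finB: "finite B" and finE: "finite E" using Suc.prems(1) by (auto simp: B_def)
  show ?case
  proof (cases "card E \<le> 2 * card B")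
    case True
    have "card E > 0" using Suc.prems(1,2) by (simp add: card_gt_0_iff)
    then have Bne: "B \<noteq> {}" using True by auto
    have "card (?f ` B) * (2 * c) \<le> card B"
    proof (rule card_ge_fibers[OF finB])
      fix e assume "e \<in> B"
      then have "{e' \<in> B. ?f e' = ?f e} = {e' \<in> E. ?f e' = ?f e}" by (auto simp: B_def)
      then show "2 * c \<le> card {e' \<in> B. ?f e' = ?f e}" using \<open>e \<in> B\<close> by (simp add: B_def)
    qed
    moreover have "2 * c * card (g ` B) \<le> card B"
    proof -
      have "2 * (2 * c * card (g ` B)) \<le> 4 * d * c * card (g ` B)" using Suc.prems(3) by simp
      also have "\<dots> \<le> 4 * d * c * (card (p i ` E) + card (g ` E))"
        using card_mono[of "g ` E" "g ` B"] BE finE by (intro mult_le_mono2) (simp add: image_mono trans_le_add2)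
      also have "\<dots> \<le> 2 * card B" using dens True by linarith
      finally show ?thesis by simp
    qed
    ultimately have "c * (card (?f ` B) + card (g ` B)) \<le> card B" by (simp add: algebra_simps)
    then have densB: "d * (4 * d) ^ (j - Suc i) * (card (?f ` B) + card (g ` B)) \<le> card B"
      by (simp add: c_def n(1))
    have tiedB: "\<forall>t<j. \<forall>e\<in>B. \<forall>e'\<in>B. p (Suc t) e = p (Suc t) e' \<longrightarrow> p t e = p t e'"
      using Suc.prems(5) BE by blast
    from Suc.hyps(1)[OF n(1) finB Bne Suc.prems(3) n(2) tiedB densB]
    obtain i' E' where "i' \<le> j" "E' \<subseteq> B" "E' \<noteq> {}" "d * (card (p i' ` E') + card (g ` E')) \<le> card E'"
      "\<forall>t. i' < t \<longrightarrow> t \<le> j \<longrightarrow> inj_on (p t) E'" by (elim exE conjE)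
    then show ?thesis using BE by blast
  next
    case False
    define S where "S = E - B"
    have SE: "S \<subseteq> E" "finite S" using finE by (auto simp: S_def)
    have "card E = card B + card S"
      using card_Un_disjoint[of B S] finB SE(2) BE by (simp add: S_def Un_absorb1)
    then have ES: "card E \<le> 2 * card S" using False by simp
    have "card S \<le> card (?f ` S) * (2 * c)"
    proof (rule card_le_fibers[OF SE(2)])
      fix e assume "e \<in> S"
      then have "card {e' \<in> E. ?f e' = ?f e} < 2 * c" by (auto simp: S_def B_def)
      moreover have "card {e' \<in> S. ?f e' = ?f e} \<le> card {e' \<in> E. ?f e' = ?f e}"
        using SE finE by (intro card_mono) auto
      ultimately show "card {e' \<in> S. ?f e' = ?f e} \<le> 2 * c" by simp
    qed
    \<comment> \<open>Light fibres have fewer than \<open>2 * c\<close> edges, so one edge for each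
      retains a fraction \<open>1 / (4 * c)\<close> of \<open>E\<close>; of the density
      \<open>4 * d * c\<close>, exactly \<open>d\<close> is left.\<close>
    moreover obtain E' where E': "E' \<subseteq> S" "inj_on ?f E'" "?f ` S = ?f ` E'"
      using subset_image_inj[of "?f ` S" ?f S] by auto
    moreover have "card (?f ` E') = card E'" using E'(2) by (rule card_image)
    ultimately have "card E \<le> 2 * (card E' * (2 * c))" using ES by simp
    then have le: "card E \<le> 4 * c * card E'" by (simp add: mult_ac)
    have E'E: "E' \<subseteq> E" using E'(1) SE(1) by blast
    have "4 * c * (d * (card (p i ` E) + card (g ` E))) = 4 * d * c * (card (p i ` E) + card (g ` E))" by simp
    also have "\<dots> \<le> 4 * c * card E'" using dens le by (rule le_trans)
    finally have "4 * c * (d * (card (p i ` E) + card (g ` E))) \<le> 4 * c * card E'" .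
    then have "d * (card (p i ` E) + card (g ` E)) \<le> card E'" using c(1) by simp
    moreover have "d * (card (p i ` E') + card (g ` E')) \<le> d * (card (p i ` E) + card (g ` E))"
      using E'E finE by (intro mult_le_mono2 add_mono card_mono image_mono) auto
    ultimately have "d * (card (p i ` E') + card (g ` E')) \<le> card E'" by linarith
    moreover have "E' \<noteq> {}" using le Suc.prems(1,2) by auto
    moreover have "inj_on (p t) E'" if "i < t" "t \<le> j" for t
      by (rule inj_on_later_levels[of j E' p "Suc i"]) (use Suc.prems(5) E'E E'(2) that in \<open>auto simp: subset_iff\<close>)
    ultimately show ?thesis using E'E Suc.prems(4) by blast
  qed
qed

text \<open>Paths with a common root may share a segment near it, on either side. The left trees are
  peeled, then the right ones along the reversed paths, and between the levels \<open>i\<close> and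
  \<open>k\<close> where this stops an inner vertex determines its path. The first peeling has to
  leave the density \<open>d'\<close> that the second one consumes, hence the nested bound.\<close>

lemma tree_paths_imp_path_system:
  fixes p :: "nat \<Rightarrow> 'e \<Rightarrow> 'v"
  assumes fin: "finite E" and ne: "E \<noteq> {}" and d: "d > 0" and j: "j < L" "j \<le> r" "L \<le> j + r + 1"
    and left: "\<forall>t<j. \<forall>e\<in>E. \<forall>e'\<in>E. p (Suc t) e = p (Suc t) e' \<longrightarrow> p t e = p t e'"
    and right: "\<And>t e e'. j < t \<Longrightarrow> t < L \<Longrightarrow> e \<in> E \<Longrightarrow> e' \<in> E \<Longrightarrow> p t e = p t e' \<Longrightarrow> p (Suc t) e = p (Suc t) e'"
    and level: "\<And>t t' e e'. t \<le> L \<Longrightarrow> t' \<le> L \<Longrightarrow> e \<in> E \<Longrightarrow> e' \<in> E \<Longrightarrow> p t e = p t' e' \<Longrightarrow> t = t'"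
    and ends: "\<And>e e'. e \<in> E \<Longrightarrow> e' \<in> E \<Longrightarrow> p 0 e = p 0 e' \<Longrightarrow> p L e = p L e' \<Longrightarrow> e = e'"
    and arcs: "\<And>t e. e \<in> E \<Longrightarrow> t < L \<Longrightarrow> (p t e, p (Suc t) e) \<in> parcs G"
    and d': "d' = d * (4 * d) ^ r"
    and dens: "d' * (4 * d') ^ r * (card (p 0 ` E) + card (p L ` E)) \<le> card E"
  shows "\<exists>l R q. l \<le> L \<and> dense_bip d R \<and> path_system G l R q"
proof -
  have d'pos: "d' > 0" using d by (simp add: d')
  have "d' * (4 * d') ^ (j - 0) * (card (p 0 ` E) + card (p L ` E)) \<le> card E"
    using d'pos j(2) dens
    by (intro le_trans[OF _ dens] mult_le_mono1 mult_le_mono2 power_increasing) auto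
  from peel_levels[where E = E and d = d' and i = 0 and j = j and p = p and g = "p L", OF fin ne d'pos le0 left this]
  obtain i E1 where i: "i \<le> j" and E1: "E1 \<subseteq> E" "E1 \<noteq> {}" "d' * (card (p i ` E1) + card (p L ` E1)) \<le> card E1"
    "\<forall>t. i < t \<longrightarrow> t \<le> j \<longrightarrow> inj_on (p t) E1" by (elim exE conjE)
  define q where "q t = p (L - t)" for t
  define j' where "j' = L - Suc j"
  have finE1: "finite E1" using E1(1) fin finite_subset by blast
  have "d * (4 * d) ^ (j' - 0) * (card (q 0 ` E1) + card (p i ` E1)) \<le> d' * (card (q 0 ` E1) + card (p i ` E1))"
    unfolding d' using d j by (intro mult_le_mono1 mult_le_mono2 power_increasing) (auto simp: j'_def)
  also have "\<dots> \<le> card E1" using E1(3) by (simp add: q_def add.commute)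
  finally have dens1: "d * (4 * d) ^ (j' - 0) * (card (q 0 ` E1) + card (p i ` E1)) \<le> card E1" .
  have tied: "\<forall>t<j'. \<forall>e\<in>E1. \<forall>e'\<in>E1. q (Suc t) e = q (Suc t) e' \<longrightarrow> q t e = q t e'"
  proof (intro allI ballI impI)
    fix t e e' assume *: "t < j'" "e \<in> E1" "e' \<in> E1" "q (Suc t) e = q (Suc t) e'"
    then have "j < L - Suc t" "Suc t \<le> L" by (auto simp: j'_def)
    with * show "q t e = q t e'"
      using right[of "L - Suc t" e e'] E1(1) by (auto simp: q_def j'_def Suc_diff_Suc)
  qed
  from peel_levels[where E = E1 and d = d and i = 0 and j = j' and p = q and g = "p i", OF finE1 E1(2) d le0 tied dens1]
  obtain i' E2 where i': "i' \<le> j'" and E2: "E2 \<subseteq> E1" "E2 \<noteq> {}" "d * (card (q i' ` E2) + card (p i ` E2)) \<le> card E2"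
    "\<forall>t. i' < t \<longrightarrow> t \<le> j' \<longrightarrow> inj_on (q t) E2" by (elim exE conjE)
  define k where "k = L - i'"
  have k: "j < k" "k \<le> L" using i' j(1) by (auto simp: k_def j'_def)
  have E2E: "E2 \<subseteq> E" using E2(1) E1(1) by (rule subset_trans)
  have finE2: "finite E2" using E2(1) finE1 by (rule finite_subset)
  have down: "p 0 e = p 0 e'" if "p i e = p i e'" "e \<in> E" "e' \<in> E" for e e'
    using i that(1)
  proof (induction i)
    case (Suc t)
    then have tj: "t < j" "p (Suc t) e = p (Suc t) e'" by auto
    have "p t e = p t e'" by (rule left[rule_format]) (use tj that(2,3) in auto)
    then show ?case using Suc.IH tj(1) by simp
  qed simp
  have up: "p L e = p L e'" if e: "p k e = p k e'" "e \<in> E" "e' \<in> E" for e e'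
  proof -
    have "p (k + m) e = p (k + m) e'" if "k + m \<le> L" for m
      using that
    proof (induction m)
      case (Suc m)
      then have "p (Suc (k + m)) e = p (Suc (k + m)) e'" using k(1) e by (intro right) auto
      then show ?case by simp
    qed (use e in simp)
    from this[of "L - k"] show ?thesis using k(2) by simp
  qed
  \<comment> \<open>The vertices at positions \<open>i\<close> and \<open>k\<close> determine the
    two roots, and these determine the edge by \<open>ends\<close>; so no edges merge when the paths
    are shortened.\<close>
  define h where "h e = (p i e, p k e)" for e
  have inj: "inj_on h E2"
  proof (rule inj_onI)
    fix e e' assume e: "e \<in> E2" "e' \<in> E2" "h e = h e'"
    then have E: "e \<in> E" "e' \<in> E" using E2E by auto
    show "e = e'" using ends[OF E down[OF _ E] up[OF _ E]] e(3) by (simp add: h_def)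
  qed
  define R where "R = h ` E2"
  define inv where "inv = the_inv_into E2 h"
  have inv: "inv z \<in> E2" "h (inv z) = z" if "z \<in> R" for z
    using that inj by (auto simp: R_def inv_def the_inv_into_f_f)
  have DR: "Domain R = p i ` E2" "Range R = p k ` E2" by (force simp: R_def h_def)+
  have "dense_bip d R"
    using E2(2,3) finE2 card_image[OF inj]
    by (simp add: dense_bip_def DR R_def[symmetric] add.commute q_def k_def) (simp add: R_def)
  moreover have "path_system G (k - i) R (\<lambda>t z. p (i + t) (inv z))"
    unfolding path_system_def
  proof (intro conjI ballI allI impI)
    show "k - i > 0" using i k by simp
    fix z assume z: "z \<in> R"
    note iz = inv[OF z]
    have zE: "inv z \<in> E" using iz(1) E2E by blast
    have hz: "p i (inv z) = fst z" "p k (inv z) = snd z" using iz(2) by (metis h_def fst_conv snd_conv)+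
    show "p (i + 0) (inv z) = fst z" "p (i + (k - i)) (inv z) = snd z" using hz i k by simp_all
    show "(p (i + t) (inv z), p (i + Suc t) (inv z)) \<in> parcs G" if "t < k - i" for t
      using arcs[OF zE, of "i + t"] that k by simp
    fix z' t t' assume z': "z' \<in> R" and t: "t \<le> k - i" "t' \<le> k - i" and eq: "p (i + t) (inv z) = p (i + t') (inv z')"
    note iz' = inv[OF z']
    have z'E: "inv z' \<in> E" using iz'(1) E2E by blast
    show tt: "t = t'" using level[OF _ _ zE z'E eq] t k i by simp
    show "z = z' \<or> t = 0 \<or> t = k - i"
    proof (rule ccontr)
      assume "\<not> ?thesis"
      then have neq: "z \<noteq> z'" "0 < t" "i + t < k" using t by auto
      \<comment> \<open>Inner positions up to \<open>j\<close> are covered by the first peeling,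
        later ones by the second.\<close>
      have "inj_on (p (i + t)) E2"
      proof (cases "i + t \<le> j")
        case True
        then show ?thesis using E1(4)[rule_format, of "i + t"] neq E2(1) inj_on_subset by auto
      next
        case False
        then have "inj_on (q (L - (i + t))) E2"
          using neq k by (intro E2(4)[rule_format]) (auto simp: j'_def k_def)
        then show ?thesis using neq k by (simp add: q_def)
      qed
      then have "inv z = inv z'" using iz(1) iz'(1) eq tt by (simp add: inj_on_def)
      then show False using iz(2) iz'(2) neq(1) by metis
    qed
  qed
  moreover have "k - i \<le> L" using k by simp
  ultimately show ?thesis by blast
qed

section \<open>Trees inside the branch sets of a depth minor\<close>

lemma breadth_first_tree:
  assumes S: "pair_graph S" and rad: "graph_radius S \<le> ereal (real r)"
  shows "\<exists>dep par. (\<forall>x\<in>pverts S. dep x \<le> r \<and>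
            (0 < dep x \<longrightarrow> par x \<in> pverts S \<and> Suc (dep (par x)) = dep x \<and> (par x, x) \<in> parcs S)) \<and>
          (\<forall>x\<in>pverts S. \<forall>y\<in>pverts S. dep x = 0 \<longrightarrow> dep y = (0 :: nat) \<longrightarrow> x = y)"
proof -
  interpret S: pair_graph S by fact
  let ?e = "\<lambda>c. SUP v\<in>pverts S. graph_dist S c v"
  \<comment> \<open>The infimum over an empty vertex set is infinite; over a finite nonempty one it
    is attained by a centre.\<close>
  have "pverts S \<noteq> {}" using rad by (auto simp: graph_radius_def top_ereal_def)
  then have "Inf (?e ` pverts S) \<in> ?e ` pverts S"
    using S.pair_finite_verts by (subst cInf_eq_Min) (auto intro!: Min_in)
  then obtain c where c: "c \<in> pverts S" "?e c \<le> ereal (real r)"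
    using rad unfolding graph_radius_def by (metis (no_types, lifting) imageE)
  let ?A = "parcs S"
  define dep where "dep v = (LEAST m. (c, v) \<in> ?A ^^ m)" for v
  have dist: "\<exists>m\<le>r. (c, v) \<in> ?A ^^ m" if "v \<in> pverts S" for v
  proof -
    have "graph_dist S c v \<le> ?e c" using that by (rule SUP_upper)
    then show ?thesis using c graph_dist_le_iff[OF S.pair_wf_digraph c(1), of v r] by (meson order_trans)
  qed
  have dep: "(c, v) \<in> ?A ^^ dep v" "dep v \<le> r" if "v \<in> pverts S" for v
  proof -
    from dist[OF that] obtain m where m: "m \<le> r" "(c, v) \<in> ?A ^^ m" by blast
    show "(c, v) \<in> ?A ^^ dep v" unfolding dep_def by (rule LeastI[of _ m]) (rule m(2))
    have "dep v \<le> m" unfolding dep_def by (rule Least_le) (rule m(2))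
    then show "dep v \<le> r" using m(1) by simp
  qed
  have dep_le: "dep v \<le> m" if "(c, v) \<in> ?A ^^ m" for v m
    unfolding dep_def using that by (rule Least_le)
  have "\<exists>w. w \<in> pverts S \<and> Suc (dep w) = dep v \<and> (w, v) \<in> ?A" if v: "v \<in> pverts S" "0 < dep v" for v
  proof -
    obtain m where m: "dep v = Suc m" using v(2) by (cases "dep v") auto
    then obtain w where w: "(c, w) \<in> ?A ^^ m" "(w, v) \<in> ?A" using dep(1)[OF v(1)] by (auto elim: relpow_Suc_E)
    have wS: "w \<in> pverts S" using w(2) S.in_arcsD1 by blast
    have "dep v \<le> Suc (dep w)" using dep(1)[OF wS] w(2) by (intro dep_le) (rule relpow_Suc_I)
    then show ?thesis using dep_le[OF w(1)] m wS w(2) by auto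
  qed
  then obtain par where "\<And>v. v \<in> pverts S \<Longrightarrow> 0 < dep v \<Longrightarrow> par v \<in> pverts S \<and> Suc (dep (par v)) = dep v \<and> (par v, v) \<in> ?A"
    by metis
  moreover have "x = c" if "x \<in> pverts S" "dep x = 0" for x using dep(1)[OF that(1)] that(2) by simp
  ultimately show ?thesis using dep(2) by (intro exI[of _ dep] exI[of _ par]) blast
qed

text \<open>Disjointness of the branch sets lets their breadth-first trees be glued into one depth
  and one parent function. A vertex outside all contracted subgraphs is a tree of depth 0.\<close>

lemma depth_minor_forest:
  assumes "depth_minor r M G"
  shows "\<exists>H dep par. graph_subgraph H G \<and> disjoint (pverts M) \<and>
     (\<forall>A B. (A, B) \<in> parcs M \<longrightarrow> (\<exists>a\<in>A. \<exists>b\<in>B. (a, b) \<in> parcs H)) \<and>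
     (\<forall>A\<in>pverts M. (\<forall>x\<in>A. dep x \<le> r \<and>
            (0 < dep x \<longrightarrow> par x \<in> A \<and> Suc (dep (par x)) = dep x \<and> (par x, x) \<in> parcs H)) \<and>
          (\<forall>x\<in>A. \<forall>y\<in>A. dep x = 0 \<longrightarrow> dep y = (0 :: nat) \<longrightarrow> x = y))"
proof -
  from assms obtain H \<S> where H: "graph_subgraph H G"
    and S: "\<And>S. S \<in> \<S> \<Longrightarrow> graph_subgraph S H \<and> graph_radius S \<le> ereal (real r)"
    and disj: "pairwise (\<lambda>S T. pverts S \<inter> pverts T = {}) \<S>" and M: "M = contract H \<S>"
    unfolding depth_minor_def by blast
  let ?tree = "\<lambda>A dep par. (\<forall>x\<in>A. dep x \<le> r \<and>
            (0 < dep x \<longrightarrow> par x \<in> A \<and> Suc (dep (par x)) = dep x \<and> (par x, x) \<in> parcs H)) \<and>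
          (\<forall>x\<in>A. \<forall>y\<in>A. dep x = 0 \<longrightarrow> dep y = (0 :: nat) \<longrightarrow> x = y)"
  have dM: "disjoint (pverts M)"
  proof (rule disjointI)
    fix A B assume AB: "A \<in> pverts M" "B \<in> pverts M" "A \<noteq> B"
    show "A \<inter> B = {}"
    proof (rule ccontr)
      assume "A \<inter> B \<noteq> {}"
      then obtain x where x: "x \<in> A" "x \<in> B" by blast
      show False
      proof (cases "\<exists>S\<in>\<S>. x \<in> pverts S")
        case True
        then obtain S T where "S \<in> \<S>" "T \<in> \<S>" "A = pverts S" "B = pverts T"
          using AB(1,2) x by (auto simp: M contract_def contract_verts_def)
        then show False using pairwiseD[OF disj, of S T] AB(3) x by auto
      next
        case False
        then have "A = {x}" "B = {x}" using AB(1,2) x by (auto simp: M contract_def contract_verts_def)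
        then show False using AB(3) by simp
      qed
    qed
  qed
  have "\<exists>dep par. ?tree A dep par" if A: "A \<in> pverts M" for A
  proof -
    consider S where "S \<in> \<S>" "A = pverts S" | v where "A = {v}"
      using A by (auto simp: M contract_def contract_verts_def)
    then show ?thesis
    proof cases
      case 1
      have "parcs S \<subseteq> parcs H" and "pair_graph S"
        using S[OF 1(1)] by (auto simp: graph_subgraph_def subgraph_def)
      then show ?thesis using breadth_first_tree[of S r] S[OF 1(1)] 1(2) by (metis subsetD)
    next
      case 2
      then show ?thesis by (intro exI[of _ "\<lambda>_. 0"]) auto
    qed
  qed
  then obtain dep par where tree: "\<And>A. A \<in> pverts M \<Longrightarrow> ?tree A (dep A) (par A)" by metis
  define blk where "blk x = (THE A. A \<in> pverts M \<and> x \<in> A)" for x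
  have blk: "blk x = A" if "x \<in> A" "A \<in> pverts M" for x A
    unfolding blk_def using that dM by (intro the_equality) (auto simp: disjoint_def)
  have "?tree A (\<lambda>x. dep (blk x) x) (\<lambda>x. par (blk x) x)" if A: "A \<in> pverts M" for A
    using tree[OF A] blk[OF _ A] by simp
  moreover have "\<exists>a\<in>A. \<exists>b\<in>B. (a, b) \<in> parcs H" if "(A, B) \<in> parcs M" for A B
    using that by (auto simp: M contract_def)
  ultimately show ?thesis using H dM
    by (intro exI[of _ H] exI[of _ "\<lambda>x. dep (blk x) x"] exI[of _ "\<lambda>x. par (blk x) x"]) blast
qed

text \<open>A given arc leaves exactly a quarter of all subsets \<open>X\<close> of
  \<open>V\<close>, so the average over \<open>X\<close> gives the bound.\<close>

lemma bipartition_arcs: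
  assumes fin: "finite V" and A: "A \<subseteq> V \<times> V" "irrefl A"
  shows "\<exists>X \<subseteq> V. card A \<le> 4 * card {e \<in> A. fst e \<in> X \<and> snd e \<notin> X}"
proof (rule ccontr)
  assume "\<not> ?thesis"
  then have small: "4 * card {e \<in> A. fst e \<in> X \<and> snd e \<notin> X} < card A" if "X \<in> Pow V" for X using that by auto
  have finA: "finite A" using A(1) fin finite_subset by blast
  have half: "4 * card {X \<in> Pow V. fst e \<in> X \<and> snd e \<notin> X} = 2 ^ card V" if "e \<in> A" for e
  proof -
    have e: "fst e \<in> V" "snd e \<in> V" "fst e \<noteq> snd e" using that A by (auto simp: irrefl_def)
    have "{X \<in> Pow V. fst e \<in> X \<and> snd e \<notin> X} = insert (fst e) ` Pow (V - {fst e, snd e})"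
    proof (intro equalityI subsetI)
      fix X assume "X \<in> {X \<in> Pow V. fst e \<in> X \<and> snd e \<notin> X}"
      then show "X \<in> insert (fst e) ` Pow (V - {fst e, snd e})"
        by (intro image_eqI[of _ _ "X - {fst e}"]) auto
    qed (use e in auto)
    moreover have "inj_on (insert (fst e)) (Pow (V - {fst e, snd e}))"
      by (rule inj_onI) (metis Diff_iff Diff_insert_absorb PowD insertI1 subsetD)
    ultimately have "card {X \<in> Pow V. fst e \<in> X \<and> snd e \<notin> X} = 2 ^ card (V - {fst e, snd e})"
      using fin by (simp add: card_image card_Pow)
    moreover have "card V = card (V - {fst e, snd e}) + 2"
      using e card_Diff_subset[of "{fst e, snd e}" V] card_mono[OF fin, of "{fst e, snd e}"] by auto
    ultimately show ?thesis by (simp add: power_add)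
  qed
  have "(\<Sum>X\<in>Pow V. 4 * card {e \<in> A. fst e \<in> X \<and> snd e \<notin> X}) = (\<Sum>X\<in>Pow V. \<Sum>e\<in>A. if fst e \<in> X \<and> snd e \<notin> X then 4 else 0)"
    using finA by (simp add: sum.If_cases Int_def mult.commute)
  also have "\<dots> = (\<Sum>e\<in>A. \<Sum>X\<in>Pow V. if fst e \<in> X \<and> snd e \<notin> X then 4 else 0)" by (rule sum.swap)
  also have "\<dots> = (\<Sum>e\<in>A. 4 * card {X \<in> Pow V. fst e \<in> X \<and> snd e \<notin> X})"
    using fin by (simp add: sum.If_cases Int_def mult.commute)
  also have "\<dots> = card A * 2 ^ card V" using half by simp
  also have "\<dots> = (\<Sum>X\<in>Pow V. card A)" using fin by (simp add: card_Pow)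
  finally have eq: "(\<Sum>X\<in>Pow V. 4 * card {e \<in> A. fst e \<in> X \<and> snd e \<notin> X}) = (\<Sum>X\<in>Pow V. card A)" .
  have "(\<Sum>X\<in>Pow V. 4 * card {e \<in> A. fst e \<in> X \<and> snd e \<notin> X}) < (\<Sum>X\<in>Pow V. card A)"
    using fin small by (intro sum_strict_mono) auto
  then show False using eq by simp
qed

lemma card_parcs_eq_average_degree:
  assumes "pair_graph M"
  shows "real (card (parcs M)) = average_degree M * real (card (pverts M))"
proof -
  interpret M: pair_graph M by fact
  have "out_degree (with_proj M) v = card (parcs M `` {v})" for v
  proof -
    have "out_arcs (with_proj M) v = Pair v ` (parcs M `` {v})" by (auto simp: out_arcs_def)
    then show ?thesis by (simp add: out_degree_def card_image inj_on_def)
  qed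
  moreover have "card (parcs M) = (\<Sum>v\<in>pverts M. card (parcs M `` {v}))"
    using M.in_arcsD1 M.pair_finite_verts M.pair_finite_arcs by (intro card_eq_sum_Image) auto
  ultimately show ?thesis
    using M.pair_finite_verts by (cases "pverts M = {}") (simp_all add: average_degree_def)
qed

text \<open>An arc of the minor becomes a path from root to root through a representing arc of
  \<open>H\<close>. Fixing the depths of both ends of that arc makes all paths equally long, and
  lets depth reveal the position on a path. Restricting to arcs that leave \<open>X\<close>
  separates left trees from right trees.\<close>

theorem depth_minor_path_system:
  assumes d: "d > 0"
  shows "\<exists>N. \<forall>(G :: 'a pair_pre_digraph) M. pair_graph G \<longrightarrow> depth_minor r M G \<longrightarrow> real N < average_degree M \<longrightarrow>
           (\<exists>l R p. l \<le> 2 * r + 1 \<and> dense_bip d R \<and> path_system G l R p)"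
proof -
  define d' where "d' = d * (4 * d) ^ r"
  define c where "c = d' * (4 * d') ^ r"
  \<comment> \<open>The factor 4 pays for the bipartition, \<open>Suc r * Suc r\<close> for fixing
    two depths, and \<open>c\<close> is what the two peelings consume.\<close>
  define N where "N = 4 * (Suc r * Suc r) * c"
  show ?thesis
  proof (rule exI[of _ N], intro allI impI)
    fix G :: "'a pair_pre_digraph" and M
    assume G: "pair_graph G" and M: "depth_minor r M G" and avg: "real N < average_degree M"
    interpret G: pair_graph G by fact
    interpret M: pair_graph M using M by (rule pair_graph_depth_minor)
    define V where "V = pverts M"
    have finV: "finite V" using M.pair_finite_verts by (simp add: V_def)
    from depth_minor_forest[OF M] obtain H dep par where H: "graph_subgraph H G" and dV: "disjoint V"
      and ar: "\<forall>A B. (A, B) \<in> parcs M \<longrightarrow> (\<exists>a\<in>A. \<exists>b\<in>B. (a, b) \<in> parcs H)"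
      and tree: "\<forall>A\<in>V. (\<forall>x\<in>A. dep x \<le> r \<and>
            (0 < dep x \<longrightarrow> par x \<in> A \<and> Suc (dep (par x)) = dep x \<and> (par x, x) \<in> parcs H)) \<and>
          (\<forall>x\<in>A. \<forall>y\<in>A. dep x = 0 \<longrightarrow> dep y = (0 :: nat) \<longrightarrow> x = y)"
      unfolding V_def by (elim exE conjE)
    have depr: "dep x \<le> r" and par: "0 < dep x \<Longrightarrow> par x \<in> A \<and> Suc (dep (par x)) = dep x \<and> (par x, x) \<in> parcs H"
      if "A \<in> V" "x \<in> A" for A x
      using tree that by auto
    have root: "x = y" if "A \<in> V" "x \<in> A" "y \<in> A" "dep x = 0" "dep y = 0" for A x y
      using tree that by blast
    have same: "A = B" if "A \<in> V" "B \<in> V" "x \<in> A" "x \<in> B" for A B x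
      using dV that by (auto simp: disjoint_def)
    interpret H: pair_graph H using H by (simp add: graph_subgraph_def)
    have HG: "parcs H \<subseteq> parcs G" using H by (auto simp: graph_subgraph_def subgraph_def)
    have PV: "parcs M \<subseteq> V \<times> V" using M.in_arcsD1 M.in_arcsD2 by (auto simp: V_def)
    have "irrefl (parcs M)" using M.no_loops' by (auto simp: irrefl_def)
    from bipartition_arcs[OF finV PV this] obtain X where X: "X \<subseteq> V"
      "card (parcs M) \<le> 4 * card {e \<in> parcs M. fst e \<in> X \<and> snd e \<notin> X}" by blast
    define E1 where "E1 = {e \<in> parcs M. fst e \<in> X \<and> snd e \<notin> X}"
    have "\<exists>ab. fst ab \<in> fst e \<and> snd ab \<in> snd e \<and> ab \<in> parcs H" if "e \<in> E1" for e
      using ar[rule_format, of "fst e" "snd e"] that by (auto simp: E1_def)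
    then obtain rep where rep: "\<And>e. e \<in> E1 \<Longrightarrow> fst (rep e) \<in> fst e \<and> snd (rep e) \<in> snd e \<and> rep e \<in> parcs H" by metis
    have E1V: "fst e \<in> X" "fst e \<in> V" "snd e \<in> V - X" if "e \<in> E1" for e
      using that PV X(1) by (auto simp: E1_def)
    have finE1: "finite E1" using M.pair_finite_arcs by (simp add: E1_def)
    have big: "N * card V < card (parcs M)"
    proof -
      have "V \<noteq> {}" using avg by (auto simp: average_degree_def V_def)
      then have "real N * real (card V) < average_degree M * real (card V)"
        using avg finV by (simp add: card_gt_0_iff)
      then show ?thesis
        using card_parcs_eq_average_degree[OF M.pair_graph] by (simp add: V_def flip: of_nat_mult)
    qed
    then have E1ne: "E1 \<noteq> {}" using X(2) by (auto simp: E1_def[symmetric])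
    define depths where "depths e = (dep (fst (rep e)), dep (snd (rep e)))" for e
    have "depths e \<in> {..r} \<times> {..r}" if "e \<in> E1" for e
      using depr[of "fst e" "fst (rep e)"] depr[of "snd e" "snd (rep e)"] E1V[OF that] rep[OF that]
      by (simp add: depths_def)
    then have "depths ` E1 \<subseteq> {..r} \<times> {..r}" by blast
    from large_fiber[OF _ finE1 E1ne this] obtain j j' where
      jj: "card E1 \<le> card ({..r} \<times> {..r}) * card {e \<in> E1. depths e = (j, j')}" by auto
    define E where "E = {e \<in> E1. depths e = (j, j')}"
    have EE1: "E \<subseteq> E1" by (auto simp: E_def)
    have finE: "finite E" using finE1 by (simp add: E_def)
    have "4 * (Suc r * Suc r) * (c * card V) = N * card V" by (simp add: N_def)
    also have "\<dots> < card (parcs M)" by (rule big)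
    also have "\<dots> \<le> 4 * card E1" using X(2) by (simp add: E1_def)
    also have "\<dots> \<le> 4 * (Suc r * Suc r * card E)"
      using jj by (intro mult_le_mono2) (simp only: E_def card_cartesian_product card_atMost)
    also have "\<dots> = 4 * (Suc r * Suc r) * card E" by (rule mult.assoc[symmetric])
    finally have cE: "c * card V < card E" by (simp only: mult_less_cancel1)
    then have Ene: "E \<noteq> {}" by auto
    \<comment> \<open>Ancestors of the left end, from the root down, then those of the right end, up
      to its root: position \<open>t\<close> has depth \<open>t\<close> on the left and
      \<open>L - t\<close> on the right.\<close>
    define p where "p t e = (if t \<le> j then (par ^^ (j - t)) (fst (rep e)) else (par ^^ (t - Suc j)) (snd (rep e)))" for t e
    define L where "L = Suc (j + j')"
    have climb: "(par ^^ n) x \<in> A \<and> dep ((par ^^ n) x) = dep x - n" if "A \<in> V" "x \<in> A" "n \<le> dep x" for A x n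
      using that(3)
    proof (induction n)
      case (Suc n)
      then have "(par ^^ n) x \<in> A" "dep ((par ^^ n) x) = dep x - n" by auto
      then show ?case using par[OF that(1), of "(par ^^ n) x"] Suc.prems by auto
    qed (use that in simp)
    have j: "dep (fst (rep e)) = j" "dep (snd (rep e)) = j'" if "e \<in> E" for e
      using that by (auto simp: E_def depths_def)
    have EV: "fst e \<in> V" "snd e \<in> V" "fst e \<in> X" "snd e \<notin> X" if "e \<in> E" for e
      using E1V[of e] that EE1 by auto
    have repE: "fst (rep e) \<in> fst e" "snd (rep e) \<in> snd e" "rep e \<in> parcs H" if "e \<in> E" for e
      using rep[of e] that EE1 by auto
    have left: "p t e \<in> fst e \<and> dep (p t e) = t" if "e \<in> E" "t \<le> j" for e t
      using climb[OF EV(1)[OF that(1)] repE(1)[OF that(1)], of "j - t"] j[OF that(1)] that(2) by (simp add: p_def)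
    have right: "p t e \<in> snd e \<and> dep (p t e) = L - t" if "e \<in> E" "j < t" "t \<le> L" for e t
      using climb[OF EV(2)[OF that(1)] repE(2)[OF that(1)], of "t - Suc j"] j[OF that(1)] that(2,3) by (auto simp: p_def L_def)
    have pl: "p t e = par (p (Suc t) e)" if "t < j" for t e
      using that by (simp add: p_def flip: Suc_diff_Suc[of t j])
    have pr: "p (Suc t) e = par (p t e)" if "j < t" for t e
    proof -
      have "t - j = Suc (t - Suc j)" using that by simp
      then show ?thesis using that by (simp add: p_def)
    qed
    have "\<exists>l R q. l \<le> L \<and> dense_bip d R \<and> path_system G l R q"
    proof (rule tree_paths_imp_path_system[OF finE Ene d])
      obtain e where e: "e \<in> E" using Ene by blast
      have "j \<le> r" "j' \<le> r" using depr[OF EV(1)[OF e] repE(1)[OF e]] depr[OF EV(2)[OF e] repE(2)[OF e]] j[OF e] by simp_all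
      then show "j < L" "j \<le> r" "L \<le> j + r + 1" by (auto simp: L_def)
      show "\<forall>t<j. \<forall>e\<in>E. \<forall>e'\<in>E. p (Suc t) e = p (Suc t) e' \<longrightarrow> p t e = p t e'" using pl by simp
      show "p (Suc t) e = p (Suc t) e'" if "j < t" "p t e = p t e'" for t e e' using pr that by simp
      \<comment> \<open>A common vertex would force one branch set to lie both in \<open>X\<close>
        and outside it.\<close>
      have mixed: False if "e \<in> E" "e' \<in> E" "t \<le> j" "j < t'" "t' \<le> L" "p t e = p t' e'" for e e' t t'
        using left[OF that(1,3)] right[OF that(2,4,5)] that(6) same[OF EV(1)[OF that(1)] EV(2)[OF that(2)]]
          EV(3)[OF that(1)] EV(4)[OF that(2)] by metis
      show "t = t'" if "t \<le> L" "t' \<le> L" "e \<in> E" "e' \<in> E" "p t e = p t' e'" for t t' e e'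
      proof (cases "t \<le> j"; cases "t' \<le> j")
        assume "t \<le> j" "t' \<le> j"
        then show ?thesis using left[OF that(3)] left[OF that(4)] that(5) by metis
      next
        assume "t \<le> j" "\<not> t' \<le> j"
        then show ?thesis using mixed[OF that(3,4) _ _ that(2,5)] by simp
      next
        assume "\<not> t \<le> j" "t' \<le> j"
        then show ?thesis using mixed[OF that(4,3) _ _ that(1) that(5)[symmetric]] by simp
      next
        assume "\<not> t \<le> j" "\<not> t' \<le> j"
        then have "L - t = L - t'" using right[OF that(3)] right[OF that(4)] that by (metis not_le)
        then show ?thesis using that(1,2) by simp
      qed
      have l0: "p 0 e \<in> fst e \<and> dep (p 0 e) = 0" and rL: "p L e \<in> snd e \<and> dep (p L e) = 0" if "e \<in> E" for e
        using left[OF that, of 0] right[OF that, of L] by (auto simp: L_def)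
      show "e = e'" if "e \<in> E" "e' \<in> E" "p 0 e = p 0 e'" "p L e = p L e'" for e e'
      proof (rule prod_eqI)
        show "fst e = fst e'" using same[OF EV(1)[OF that(1)] EV(1)[OF that(2)], of "p 0 e"] l0[OF that(1)] l0[OF that(2)] that(3) by simp
        show "snd e = snd e'" using same[OF EV(2)[OF that(1)] EV(2)[OF that(2)], of "p L e"] rL[OF that(1)] rL[OF that(2)] that(4) by simp
      qed
      show "(p t e, p (Suc t) e) \<in> parcs G" if e: "e \<in> E" and t: "t < L" for t e
      proof -
        consider "t < j" | "t = j" | "j < t" by linarith
        then have "(p t e, p (Suc t) e) \<in> parcs H"
        proof cases
          case 1
          then show ?thesis
            using left[OF e, of "Suc t"] par[OF EV(1)[OF e], of "p (Suc t) e"] pl[OF 1, of e] by simp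
        next
          case 2
          then show ?thesis using repE(3)[OF e] by (simp add: p_def)
        next
          case 3
          then have "(par (p t e), p t e) \<in> parcs H"
            using right[OF e 3] par[OF EV(2)[OF e], of "p t e"] t by simp
          then show ?thesis using pr[OF 3] H.arcs_symmetric by simp
        qed
        then show ?thesis using HG by blast
      qed
      show "d' = d * (4 * d) ^ r" by (rule d'_def)
      \<comment> \<open>The first and last positions are roots, so the ends of the paths are no more
        numerous than the branch sets.\<close>
      define rt where "rt A = (THE x. x \<in> A \<and> dep x = 0)" for A
      have rt: "rt A = x" if "A \<in> V" "x \<in> A" "dep x = 0" for A x
        unfolding rt_def using that root by (intro the_equality) auto
      have "p 0 e = rt (fst e)" if "e \<in> E" for e using rt[OF EV(1)[OF that], of "p 0 e"] l0[OF that] by simp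
      then have "p 0 ` E \<subseteq> rt ` X" using EV(3) by blast
      then have "card (p 0 ` E) \<le> card X"
        using finite_subset[OF X(1) finV] by (meson card_image_le card_mono finite_imageI le_trans)
      moreover have "p L e = rt (snd e)" if "e \<in> E" for e using rt[OF EV(2)[OF that], of "p L e"] rL[OF that] by simp
      then have "p L ` E \<subseteq> rt ` (V - X)" using EV(2,4) by blast
      then have "card (p L ` E) \<le> card (V - X)"
        using finV by (meson card_image_le card_mono finite_Diff finite_imageI le_trans)
      moreover have "card V = card X + card (V - X)"
        using X(1) finV by (metis card_Diff_subset card_mono finite_subset le_add_diff_inverse)
      ultimately have "card (p 0 ` E) + card (p L ` E) \<le> card V" by linarith
      then have "c * (card (p 0 ` E) + card (p L ` E)) \<le> c * card V" by (rule mult_le_mono2)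
      then show "d' * (4 * d') ^ r * (card (p 0 ` E) + card (p L ` E)) \<le> card E"
        unfolding c_def[symmetric] using cE by linarith
    qed
    moreover have "L \<le> 2 * r + 1"
    proof -
      obtain e where e: "e \<in> E" using Ene by blast
      have "j \<le> r" "j' \<le> r" using depr[OF EV(1)[OF e] repE(1)[OF e]] depr[OF EV(2)[OF e] repE(2)[OF e]] j[OF e] by simp_all
      then show ?thesis by (simp add: L_def)
    qed
    ultimately show "\<exists>l R p. l \<le> 2 * r + 1 \<and> dense_bip d R \<and> path_system G l R p"
      by (meson le_trans)
  qed
qed

section \<open>From sketch sizes to the density of depth minors\<close>

theorem theorem4p19:
  fixes \<F> :: "nat pair_pre_digraph set" and f :: "nat \<Rightarrow> nat"
  assumes "graph_class \<F>"
    and "monotone_class \<F>"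
    and "\<And>r. r \<ge> 1 \<Longrightarrow> has_distance_sketch \<F> r (5 * r - 1) (f r)"
  shows "bounded_expansion \<F>"
proof -
  have "\<exists>N :: nat. \<forall>G\<in>\<F>. \<forall>M. depth_minor r M G \<longrightarrow> average_degree M \<le> N" for r
  proof -
    \<comment> \<open>Paths have length at most \<open>2 * r + 1\<close>, doubled by a subdivision;
      the maximum covers whichever length occurs.\<close>
    define s where "s = Max (f ` {..2 * (2 * r + 1)})"
    have s: "f l \<le> s" if "l \<le> 2 * (2 * r + 1)" for l
      unfolding s_def using that by (intro Max_ge) auto
    define k where "k = 13 * s + 1"
    obtain D where D: "\<And>R :: (nat \<times> nat) set. dense_bip D R \<Longrightarrow>
      \<exists>Q. dense_bip k Q \<and> C4_free Q \<and> (Q \<subseteq> R \<or> Q \<subseteq> R\<inverse> \<or> one_subdivision Q R \<or> one_subdivision Q (R\<inverse>))"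
      using dense_imp_C4_free_or_subdivision[of k, where 'a = nat] by (auto simp: k_def)
    \<comment> \<open>\<open>D\<close> may be 0, whereas path systems are extracted for a positive
      density.\<close>
    have Suc_D: "dense_bip D R" if "dense_bip (Suc D) R" for R :: "(nat \<times> nat) set"
      using that by (auto simp: dense_bip_def)
    obtain N where N: "\<And>(G :: nat pair_pre_digraph) M. pair_graph G \<Longrightarrow> depth_minor r M G \<Longrightarrow> real N < average_degree M \<Longrightarrow>
           (\<exists>l R p. l \<le> 2 * r + 1 \<and> dense_bip (Suc D) R \<and> path_system G l R (p :: nat \<Rightarrow> nat \<times> nat \<Rightarrow> nat))"
      using depth_minor_path_system[of "Suc D" r, where 'a = nat] by blast
    have "average_degree M \<le> N" if G: "G \<in> \<F>" and M: "depth_minor r M G" for G M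
    proof (rule ccontr)
      assume "\<not> average_degree M \<le> N"
      moreover have pG: "pair_graph G" using assms(1) G by (simp add: graph_class_def)
      ultimately obtain l R p where l: "l \<le> 2 * r + 1" and R: "dense_bip (Suc D) R" and p: "path_system G l R p"
        using N[OF _ M] by auto
      interpret G: pair_graph G by fact
      have sym: "sym (parcs G)" using G.arcs_symmetric by (auto intro: symI)
      note p' = path_system_converse[OF p sym]
      obtain Q where Q: "dense_bip k Q" "C4_free Q"
        "Q \<subseteq> R \<or> Q \<subseteq> R\<inverse> \<or> one_subdivision Q R \<or> one_subdivision Q (R\<inverse>)"
        using D[OF Suc_D[OF R]] by blast
      have "\<exists>l' \<le> 2 * (2 * r + 1). \<exists>q. path_system G l' Q q"
        using Q(3)
      proof (elim disjE)
        assume "Q \<subseteq> R"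
        then show ?thesis using path_system_subset[OF p] l by (intro exI[of _ l]) auto
      next
        assume "Q \<subseteq> R\<inverse>"
        then show ?thesis using path_system_subset[OF p'] l by (intro exI[of _ l]) auto
      next
        assume "one_subdivision Q R"
        then show ?thesis using path_system_one_subdivision[OF p sym] l by (intro exI[of _ "2 * l"]) auto
      next
        assume "one_subdivision Q (R\<inverse>)"
        then show ?thesis using path_system_one_subdivision[OF p' sym] l by (intro exI[of _ "2 * l"]) auto
      qed
      then obtain l' q where l': "l' \<le> 2 * (2 * r + 1)" and q: "path_system G l' Q q" by blast
      have finQ: "finite Q" "Q \<noteq> {}" using Q(1) by (auto simp: dense_bip_def)
      have "has_distance_sketch \<F> l' (5 * l' - 1) (f l')" using assms(3)[of l'] path_systemD(1)[OF q] by simp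
      from sketch_bounds_path_system[OF assms(2) this G pG q Q(2) finQ(1)]
      have "card Q \<le> 13 * f l' * (card (Domain Q) + card (Range Q))" .
      also have "\<dots> \<le> 13 * s * (card (Domain Q) + card (Range Q))" using s[OF l'] by simp
      also have "\<dots> < k * (card (Domain Q) + card (Range Q))"
        using finQ by (simp add: k_def card_gt_0_iff finite_Domain Domain_empty_iff)
      also have "\<dots> \<le> card Q" using Q(1) by (simp add: dense_bip_def)
      finally show False by simp
    qed
    then show ?thesis by blast
  qed
  then obtain N :: "nat \<Rightarrow> nat" where "\<And>r. \<forall>G\<in>\<F>. \<forall>M. depth_minor r M G \<longrightarrow> average_degree M \<le> N r" by metis
  then show ?thesis unfolding bounded_expansion_def by (intro exI[of _ "\<lambda>r. real (N r)"]) blast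
qed

end
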